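(* Let $h_{i,j}:E^2\to\mathbb{R}$, $i,j\ge1$, be measurable functions, and let $$c_i(x)=\sum_{j=1}^\infty E_Y\big(h_{i,j}^2(x,Y_j)\wedge1\big),\qquad d_j(y)=\sum_{i=1}^\infty E_X\big(h_{i,j}^2(X_i,y)\wedge1\big).$$ Then the following conditions (A), (B), (C) are equivalent: (A) $\displaystyle\sum_{i,j=1}^n\varepsilon^{(1)}_i\varepsilon^{(2)}_jh_{i,j}(X_i,Y_j)$ converges a.s. (to a finite limit) as $n\to\infty$; (B) $\displaystyle\sum_{i,j=1}^\infty h_{i,j}^2(X_i,Y_j)<\infty$ a.s.; (C) all three of the following hold: (C1) $c_i(X_i)<\infty$ a.s. for all $i$ and $d_j(Y_j)<\infty$ a.s. for all $j$; (C2) $\sum_{i=1}^\infty P(c_i(X_i)>1)<\infty$ and $\sum_{j=1}^\infty P(d_j(Y_j)>1)<\infty$; (C3) $\displaystyle\sum_{i,j=1}^\infty E\Big[\big(h_{i,j}^2(X_i,Y_j)\wedge1\big)I_{\{c_i(X_i)\le1,\ d_j(Y_j)\le1\}}\Big]<\infty.$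
   Context: $(X_i)_{i\ge1}$ is a sequence of i.i.d. random variables with values in a measurable space $E$, and $(Y_j)_{j\ge1}$ is an independent copy of it. $(\varepsilon^{(1)}_i)_{i\ge1}$ and $(\varepsilon^{(2)}_j)_{j\ge1}$ are independent Rademacher sequences (i.i.d. symmetric $\pm1$ variables), independent of $(X_i),(Y_j)$. $E_X$ and $E_Y$ denote expectation with respect to $(X_i)$ and $(Y_j)$ respectively; $a\wedge b=\min(a,b)$. The functions $c_i,d_j$ take values in $[0,\infty]$. *)

theory Defs
  imports "HOL-Probability.Probability"
begin

datatype var_index = VX nat | VY nat | VEps1 nat | VEps2 nat

(* The underlying variables take values in different types, so their joint independence is
   expressed through the generated sigma-algebras instead of indep_vars. *)
locale decoupled_rademacher = prob_space M
  for M :: "'a measure" +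
  fixes E :: "'e measure"
    and X Y :: "nat \<Rightarrow> 'a \<Rightarrow> 'e"
    and \<epsilon>1 \<epsilon>2 :: "nat \<Rightarrow> 'a \<Rightarrow> real"
  assumes measurable_X: "\<And>i. X i \<in> measurable M E"
    and measurable_Y: "\<And>j. Y j \<in> measurable M E"
    and measurable_eps1: "\<And>i. \<epsilon>1 i \<in> borel_measurable M"
    and measurable_eps2: "\<And>j. \<epsilon>2 j \<in> borel_measurable M"
    and distr_X: "\<And>i. distr M E (X i) = distr M E (X 0)"
    and distr_Y: "\<And>j. distr M E (Y j) = distr M E (X 0)"
    and rademacher_eps1:
      "\<And>i. prob {\<omega> \<in> space M. \<epsilon>1 i \<omega> = 1} = 1/2"
      "\<And>i. prob {\<omega> \<in> space M. \<epsilon>1 i \<omega> = - 1} = 1/2"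
    and rademacher_eps2:
      "\<And>j. prob {\<omega> \<in> space M. \<epsilon>2 j \<omega> = 1} = 1/2"
      "\<And>j. prob {\<omega> \<in> space M. \<epsilon>2 j \<omega> = - 1} = 1/2"
    and indep_all:
      "indep_sets (\<lambda>k. case k of
           VX i \<Rightarrow> sets (vimage_algebra (space M) (X i) E)
         | VY j \<Rightarrow> sets (vimage_algebra (space M) (Y j) E)
         | VEps1 i \<Rightarrow> sets (vimage_algebra (space M) (\<epsilon>1 i) borel)
         | VEps2 j \<Rightarrow> sets (vimage_algebra (space M) (\<epsilon>2 j) borel)) UNIV"

definition row_sum ::
  "'a measure \<Rightarrow> (nat \<Rightarrow> 'a \<Rightarrow> 'e) \<Rightarrow> (nat \<Rightarrow> nat \<Rightarrow> 'e \<times> 'e \<Rightarrow> real) \<Rightarrow> nat \<Rightarrow> 'e \<Rightarrow> ennreal"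
where
  "row_sum M Y h i x = (\<Sum>j. \<integral>\<^sup>+\<omega>. ennreal (min ((h i j (x, Y j \<omega>))\<^sup>2) 1) \<partial>M)"

definition col_sum ::
  "'a measure \<Rightarrow> (nat \<Rightarrow> 'a \<Rightarrow> 'e) \<Rightarrow> (nat \<Rightarrow> nat \<Rightarrow> 'e \<times> 'e \<Rightarrow> real) \<Rightarrow> nat \<Rightarrow> 'e \<Rightarrow> ennreal"
where
  "col_sum M X h j y = (\<Sum>i. \<integral>\<^sup>+\<omega>. ennreal (min ((h i j (X i \<omega>, y))\<^sup>2) 1) \<partial>M)"

end

theory Submission
  imports Defs
begin

text \<open>Both equivalences rest on independence used as a change of probability space: for independent \<open>U\<close> and
\<open>V\<close>, an almost sure statement about \<open>(U \<omega>, V \<omega>)\<close> is one about \<open>(U \<omega>, V \<omega>')\<close> on the product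
space, so that one argument can be frozen while the other stays random (\<open>AE_decouples_iff\<close>). The other
recurring tool is the Paley--Zygmund inequality: a variable \<open>Z\<close> with positive mean and second moment at most a
constant times \<open>(E Z)\<^sup>2\<close> exceeds half its mean with probability bounded below. Hence, if a family \<open>Z n\<close> is
bounded almost surely and each second moment is at most \<open>K (E (Z n) + (E (Z n))\<^sup>2)\<close>, the means are
bounded (\<open>bounded_expectation_if_AE_bounded\<close>). This converts almost sure statements into statements
about means.

(A) and (B). Freezing \<open>X\<close> and \<open>Y\<close> leaves a fixed real matrix \<open>a\<close>, and the claim becomes that the chaos
\<open>\<Sum>i,j<n. \<epsilon>1 i * \<epsilon>2 j * a i j\<close> converges almost surely iff \<open>a\<close> is square summable
(\<open>chaos_convergent_iff\<close>). If it converges, its squares are bounded; freezing \<open>\<epsilon>2\<close> makes it a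
Rademacher sum, whose fourth moment is at most three times its squared second moment, so the conditional
second moments are bounded almost surely. These are again random variables with comparable first and second
moments, now in \<open>\<epsilon>2\<close>, so a second application bounds their means \<open>\<Sum>i,j<n. (a i j)\<^sup>2\<close>. Conversely, splitting
the square along its diagonal writes the chaos as two Rademacher series whose coefficients depend only on
the other sequence and are almost surely square summable; such series converge by Kolmogorov's maximal
inequality.

(B) and (C). Replacing \<open>h\<^sup>2\<close> by \<open>f = min (h\<^sup>2) 1\<close> does not affect finiteness of the double sum, because
only finitely many terms can reach 1. If the sum is finite, freezing \<open>X\<close> makes each row a series of
independent terms in \<open>[0, 1]\<close>, so its mean \<open>c\<close> is finite; and since the row sums tend to 0, Paley--Zygmund
allows only finitely many rows with mean above 1 (\<open>row_means_if_finite\<close>). This gives (C1) and (C2). After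
truncation to \<open>c \<le> 1\<close> and \<open>d \<le> 1\<close>, distinct entries of the matrix are correlated only within a row or a
column, where the truncation controls them, so the partial sums satisfy the moment condition above and (C3)
follows (\<open>square_sum_second_moment\<close>). Conversely, (C3) bounds the part of the sum with \<open>c \<le> 1\<close> and
\<open>d \<le> 1\<close>; by (C2) and Borel--Cantelli the rest consists of finitely many rows and columns, each of which
has a finite sum by (C1).\<close>

section \<open>Nonnegative double series\<close>

lemma sum_ennreal_le_if_suminf_finite:
  fixes a :: "nat \<Rightarrow> real"
  assumes "(\<Sum>j. ennreal (a j)) < \<infinity>" "\<And>j. 0 \<le> a j"
  shows "\<exists>B. \<forall>n. (\<Sum>j<n. a j) \<le> B"
proof -
  obtain r where r: "0 \<le> r" "(\<Sum>j. ennreal (a j)) = ennreal r"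
    using assms(1) by (cases "\<Sum>j. ennreal (a j)") auto
  have "(\<Sum>j<n. a j) \<le> r" for n
  proof -
    have "ennreal (\<Sum>j<n. a j) = (\<Sum>j<n. ennreal (a j))"
      using assms(2) by (simp add: sum_ennreal)
    also have "\<dots> \<le> ennreal r" unfolding r(2)[symmetric] by (intro sum_le_suminf) auto
    finally show ?thesis using r(1) by (simp add: ennreal_le_iff)
  qed
  then show ?thesis by blast
qed

lemma suminf_ennreal_finite_if_sum_le:
  fixes a :: "nat \<Rightarrow> real"
  assumes "\<And>n. (\<Sum>j<n. a j) \<le> B" "\<And>j. 0 \<le> a j"
  shows "(\<Sum>j. ennreal (a j)) < \<infinity>"
proof -
  have "(\<Sum>j. ennreal (a j)) \<le> ennreal B"
    using assms by (intro suminf_le_const) (auto simp: sum_ennreal intro!: ennreal_leI)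
  then show ?thesis by (simp add: order_le_less_trans)
qed

lemma suminf_ennreal_swap:
  fixes a :: "nat \<Rightarrow> nat \<Rightarrow> ennreal"
  shows "(\<Sum>i. \<Sum>j. a i j) = (\<Sum>j. \<Sum>i. a i j)"
proof -
  have "(\<Sum>i. \<Sum>j. a i j) = (\<Sum>i. \<integral>\<^sup>+j. a i j \<partial>count_space UNIV)"
    by (simp add: nn_integral_count_space_nat)
  also have "\<dots> = (\<integral>\<^sup>+j. (\<Sum>i. a i j) \<partial>count_space UNIV)"
    by (intro nn_integral_suminf[symmetric]) auto
  also have "\<dots> = (\<Sum>j. \<Sum>i. a i j)"
    by (simp add: nn_integral_count_space_nat)
  finally show ?thesis .
qed

lemma square_sums_le_if_suminf_finite:
  fixes a :: "nat \<Rightarrow> nat \<Rightarrow> real"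
  assumes "(\<Sum>i. \<Sum>j. ennreal (a i j)) < \<infinity>" "\<And>i j. 0 \<le> a i j"
  shows "\<exists>B. \<forall>n. (\<Sum>i<n. \<Sum>j<n. a i j) \<le> B"
proof -
  obtain r where r: "0 \<le> r" "(\<Sum>i. \<Sum>j. ennreal (a i j)) = ennreal r"
    using assms(1) by (cases "\<Sum>i. \<Sum>j. ennreal (a i j)") auto
  have "(\<Sum>i<n. \<Sum>j<n. a i j) \<le> r" for n
  proof -
    have "ennreal (\<Sum>i<n. \<Sum>j<n. a i j) = (\<Sum>i<n. \<Sum>j<n. ennreal (a i j))"
      using assms(2) by (simp add: sum_nonneg)
    also have "\<dots> \<le> (\<Sum>i<n. \<Sum>j. ennreal (a i j))" by (intro sum_mono sum_le_suminf) auto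
    also have "\<dots> \<le> ennreal r" unfolding r(2)[symmetric] by (intro sum_le_suminf) auto
    finally show ?thesis using r(1) by (simp add: ennreal_le_iff)
  qed
  then show ?thesis by blast
qed

lemma suminf_suminf_finite_if_square_sums_le:
  fixes a :: "nat \<Rightarrow> nat \<Rightarrow> real"
  assumes le: "\<And>n. (\<Sum>i<n. \<Sum>j<n. a i j) \<le> B" and nonneg: "\<And>i j. 0 \<le> a i j"
  shows "(\<Sum>i. \<Sum>j. ennreal (a i j)) < \<infinity>"
proof -
  have "(\<Sum>i<m. \<Sum>j<k. ennreal (a i j)) \<le> ennreal B" for m k
  proof -
    have "(\<Sum>i<m. \<Sum>j<k. ennreal (a i j)) = ennreal (\<Sum>i<m. \<Sum>j<k. a i j)"
      using nonneg by (simp add: sum_nonneg)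
    also have "(\<Sum>i<m. \<Sum>j<k. a i j) \<le> (\<Sum>i<m. \<Sum>j<max m k. a i j)"
      using nonneg by (intro sum_mono sum_mono2) auto
    also have "\<dots> \<le> (\<Sum>i<max m k. \<Sum>j<max m k. a i j)"
      using nonneg by (intro sum_mono2) (auto intro: sum_nonneg)
    also have "\<dots> \<le> B" by (rule le)
    finally show ?thesis by (simp add: ennreal_leI)
  qed
  then have "(\<Sum>j<k. \<Sum>i<m. ennreal (a i j)) \<le> ennreal B" for m k
    by (subst sum.swap)
  then have "(\<Sum>j. \<Sum>i<m. ennreal (a i j)) \<le> ennreal B" for m
    by (intro suminf_le_const) auto
  then have "(\<Sum>i<m. \<Sum>j. ennreal (a i j)) \<le> ennreal B" for m
    by (subst (asm) suminf_sum) auto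
  then have "(\<Sum>i. \<Sum>j. ennreal (a i j)) \<le> ennreal B"
    by (intro suminf_le_const) auto
  then show ?thesis by (simp add: order_le_less_trans)
qed

text \<open>Changing finitely many terms of a series does not affect finiteness. It is used both for entries that differ
from their truncation at 1 and for exceptional rows, where \<open>v\<close> is zero.\<close>

lemma suminf_ennreal_finite_eventually_eq:
  fixes u v :: "nat \<Rightarrow> ennreal"
  assumes ev: "\<forall>\<^sub>F n in sequentially. u n = v n" and fin: "\<And>n. u n < \<infinity>" and v: "(\<Sum>n. v n) < \<infinity>"
  shows "(\<Sum>n. u n) < \<infinity>"
proof -
  obtain N where N: "\<And>n. N \<le> n \<Longrightarrow> u n = v n" using ev by (auto simp: eventually_sequentially)
  have "(\<Sum>n. u n) = (\<Sum>n. u (n + N)) + (\<Sum>n<N. u n)" by (intro suminf_offset) auto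
  also have "(\<Sum>n. u (n + N)) = (\<Sum>n. v (n + N))" using N by (intro suminf_cong) auto
  also have "\<dots> \<le> (\<Sum>n. v n)" 
    using suminf_offset[of v N] by (simp add: add_increasing2)
  finally have "(\<Sum>n. u n) \<le> (\<Sum>n. v n) + (\<Sum>n<N. u n)" by (simp add: add_right_mono)
  also have "\<dots> < \<infinity>" using v fin by (simp add: ennreal_add_less_top)
  finally show ?thesis .
qed

lemma tendsto_0_if_suminf_ennreal_finite:
  fixes u :: "nat \<Rightarrow> ennreal"
  assumes "(\<Sum>n. u n) < \<infinity>"
  shows "u \<longlonglongrightarrow> 0"
proof -
  have fin: "u n < \<infinity>" for n
    using order_le_less_trans[OF sum_le_suminf[of u "{n}"] assms] by auto
  define r where "r n = enn2real (u n)" for n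
  have u: "u n = ennreal (r n)" for n using fin[of n] by (simp add: r_def)
  have "summable r"
    using assms unfolding u by (intro summable_suminf_not_top) (auto simp: r_def)
  then show ?thesis
    unfolding u using tendsto_ennrealI[OF summable_LIMSEQ_zero] by (simp flip: ennreal_0)
qed

text \<open>If the truncated sum is finite, all but finitely many truncated row sums are below 1, and such rows are not
affected by the truncation; within each remaining row the truncated terms tend to 0, so that only finitely many
of them were cut.\<close>

lemma suminf_suminf_min_1_finite_iff:
  fixes u :: "nat \<Rightarrow> nat \<Rightarrow> real"
  assumes nonneg: "\<And>i j. 0 \<le> u i j"
  shows "(\<Sum>i. \<Sum>j. ennreal (min (u i j) 1)) < \<infinity> \<longleftrightarrow> (\<Sum>i. \<Sum>j. ennreal (u i j)) < \<infinity>"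
proof
  assume "(\<Sum>i. \<Sum>j. ennreal (u i j)) < \<infinity>"
  moreover have "(\<Sum>i. \<Sum>j. ennreal (min (u i j) 1)) \<le> (\<Sum>i. \<Sum>j. ennreal (u i j))"
    by (intro suminf_le) (auto intro: ennreal_leI)
  ultimately show "(\<Sum>i. \<Sum>j. ennreal (min (u i j) 1)) < \<infinity>" by (rule order_le_less_trans[rotated])
next
  assume fin: "(\<Sum>i. \<Sum>j. ennreal (min (u i j) 1)) < \<infinity>" (is "(\<Sum>i. ?v i) < \<infinity>")
  have eq: "u i j = min (u i j) 1" if "ennreal (min (u i j) 1) < 1" for i j
    using that by (auto simp: min_def split: if_splits)
  have row: "?v i < \<infinity>" for i
    using order_le_less_trans[OF sum_le_suminf[of ?v "{i}"] fin] by auto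
  show "(\<Sum>i. \<Sum>j. ennreal (u i j)) < \<infinity>"
  proof (rule suminf_ennreal_finite_eventually_eq[OF _ _ fin])
    have "\<forall>\<^sub>F i in sequentially. ?v i < 1"
      using tendsto_0_if_suminf_ennreal_finite[OF fin] by (rule order_tendstoD) simp
    then show "\<forall>\<^sub>F i in sequentially. (\<Sum>j. ennreal (u i j)) = ?v i"
    proof eventually_elim
      case (elim i)
      have "ennreal (min (u i j) 1) < 1" for j
        using order_le_less_trans[OF sum_le_suminf[of "\<lambda>j. ennreal (min (u i j) 1)" "{j}"] elim] by auto
      then show ?case using eq by (intro suminf_cong) metis
    qed
    show "(\<Sum>j. ennreal (u i j)) < \<infinity>" for i
    proof (rule suminf_ennreal_finite_eventually_eq[OF _ _ row])
      have "\<forall>\<^sub>F j in sequentially. ennreal (min (u i j) 1) < 1"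
        using tendsto_0_if_suminf_ennreal_finite[OF row] by (rule order_tendstoD) simp
      then show "\<forall>\<^sub>F j in sequentially. ennreal (u i j) = ennreal (min (u i j) 1)"
        by eventually_elim (use eq in metis)
    qed simp
  qed
qed

section \<open>Second-moment bounds from below\<close>

text \<open>Almost sure convergence of the indicators to 0 implies convergence of their integrals. Its contrapositive turns
a lower bound on infinitely many probabilities into an event of positive probability.\<close>

lemma (in prob_space) prob_tendsto_0_if_AE_eventually_notin:
  fixes A :: "nat \<Rightarrow> 'a set"
  assumes [measurable]: "\<And>n. A n \<in> events"
    and ev: "AE \<omega> in M. \<forall>\<^sub>F n in sequentially. \<omega> \<notin> A n"
  shows "(\<lambda>n. prob (A n)) \<longlonglongrightarrow> 0"
proof -
  have "(\<lambda>n. \<integral>\<omega>. indicat_real (A n) \<omega> \<partial>M) \<longlonglongrightarrow> (\<integral>\<omega>. 0 \<partial>M)"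
  proof (rule integral_dominated_convergence[where w="\<lambda>_. 1"])
    show "AE \<omega> in M. (\<lambda>n. indicat_real (A n) \<omega>) \<longlonglongrightarrow> 0"
      using ev
    proof eventually_elim
      case (elim \<omega>)
      have "\<forall>\<^sub>F n in sequentially. indicat_real (A n) \<omega> = 0"
        using elim by eventually_elim simp
      then show ?case by (rule tendsto_eventually)
    qed
  qed (auto simp: indicator_def)
  then show ?thesis by simp
qed

text \<open>The proof bounds \<open>Z\<close> pointwise by \<open>m/2\<close> plus a multiple of \<open>Z\<^sup>2\<close> plus a multiple of the indicator of
\<open>Z > m/2\<close>, where \<open>m\<close> is the mean, and integrates.\<close>

lemma (in prob_space) paley_zygmund:
  fixes Z :: "'a \<Rightarrow> real"
  assumes [measurable]: "Z \<in> borel_measurable M"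
    and sq: "integrable M (\<lambda>\<omega>. (Z \<omega>)\<^sup>2)"
    and pos: "0 < expectation Z"
    and le: "expectation (\<lambda>\<omega>. (Z \<omega>)\<^sup>2) \<le> C * (expectation Z)\<^sup>2"
    and C: "0 < C"
  shows "1 / (4 * C) \<le> prob {\<omega> \<in> space M. expectation Z / 2 < Z \<omega>}"
proof -
  define m where "m = expectation Z"
  define A where "A = {\<omega> \<in> space M. m / 2 < Z \<omega>}"
  have [measurable]: "A \<in> events" unfolding A_def by measurable
  have iZ: "integrable M Z"
    by (rule square_integrable_imp_integrable[OF assms(1) sq])
  have m: "0 < m" using pos by (simp add: m_def)
  \<comment> \<open>this choice makes the contribution of the second moment at most \<open>m/4\<close>, half of what is left of the mean\<close>
  define t where "t = 1 / (2 * C * m)"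
  have t: "0 < t" using m C by (simp add: t_def)
  have pt: "Z \<omega> \<le> m / 2 + t / 2 * (Z \<omega>)\<^sup>2 + indicat_real A \<omega> / (2 * t)" if "\<omega> \<in> space M" for \<omega>
  proof (cases "\<omega> \<in> A")
    case True
    have "0 \<le> (t * Z \<omega> - 1)\<^sup>2 / (2 * t)" using t by simp
    also have "\<dots> = t / 2 * (Z \<omega>)\<^sup>2 + 1 / (2 * t) - Z \<omega>"
      using t by (simp add: field_simps power2_eq_square)
    finally show ?thesis using True m by simp
  next
    case False
    then have "Z \<omega> \<le> m / 2" using that by (simp add: A_def)
    moreover have "0 \<le> t / 2 * (Z \<omega>)\<^sup>2" using t by simp
    ultimately show ?thesis using False by simp
  qed
  have iA: "integrable M (indicat_real A)"
    by (intro integrable_const_bound[where B=1]) (auto simp: indicator_def)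
  have "m \<le> expectation (\<lambda>\<omega>. m / 2 + t / 2 * (Z \<omega>)\<^sup>2 + indicat_real A \<omega> / (2 * t))"
    unfolding m_def using pt sq iZ iA
    by (intro integral_mono) (auto simp: m_def)
  also have "\<dots> = m / 2 + t / 2 * expectation (\<lambda>\<omega>. (Z \<omega>)\<^sup>2) + prob A / (2 * t)"
    using sq iA by (simp add: prob_space)
  also have "\<dots> \<le> m / 2 + t / 2 * (C * m\<^sup>2) + prob A / (2 * t)"
    using le t by (simp add: m_def mult_left_mono)
  also have "\<dots> = m / 2 + m / 4 + C * m * prob A"
    using m C by (simp add: t_def field_simps power2_eq_square)
  finally have "m * 1 \<le> m * (4 * C * prob A)" by (simp add: algebra_simps)
  then have "1 \<le> 4 * C * prob A" using m mult_le_cancel_left_pos by blast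
  then show ?thesis using C by (simp add: A_def m_def field_simps)
qed

lemma (in prob_space) paley_zygmund_frequently:
  fixes Z :: "nat \<Rightarrow> 'a \<Rightarrow> real"
  assumes [measurable]: "\<And>n. Z n \<in> borel_measurable M"
    and sq: "\<And>n. integrable M (\<lambda>\<omega>. (Z n \<omega>)\<^sup>2)"
    and freq: "\<exists>\<^sub>F n in sequentially. 0 < expectation (Z n) \<and>
      expectation (\<lambda>\<omega>. (Z n \<omega>)\<^sup>2) \<le> C * (expectation (Z n))\<^sup>2"
  shows "\<not> (AE \<omega> in M. \<forall>\<^sub>F n in sequentially. Z n \<omega> \<le> expectation (Z n) / 2)"
proof
  assume ae: "AE \<omega> in M. \<forall>\<^sub>F n in sequentially. Z n \<omega> \<le> expectation (Z n) / 2"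
  define D where "D = max C 1"
  have D: "0 < D" "C \<le> D" by (auto simp: D_def)
  define A where "A n = {\<omega> \<in> space M. expectation (Z n) / 2 < Z n \<omega>}" for n
  have [measurable]: "A n \<in> events" for n unfolding A_def by measurable
  have "(\<lambda>n. prob (A n)) \<longlonglongrightarrow> 0"
  proof (rule prob_tendsto_0_if_AE_eventually_notin)
    show "AE \<omega> in M. \<forall>\<^sub>F n in sequentially. \<omega> \<notin> A n"
      using ae by eventually_elim (auto simp: A_def elim: eventually_mono)
  qed simp
  then have "\<forall>\<^sub>F n in sequentially. prob (A n) < 1 / (4 * D)"
    using D by (intro order_tendstoD) auto
  with freq have "\<exists>\<^sub>F n in sequentially. False"
  proof (rule frequently_rev_mp[OF frequently_eventually_conj], intro always_eventually allI impI)
    fix n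
    assume n: "prob (A n) < 1 / (4 * D) \<and> 0 < expectation (Z n) \<and>
      expectation (\<lambda>\<omega>. (Z n \<omega>)\<^sup>2) \<le> C * (expectation (Z n))\<^sup>2"
    have "C * (expectation (Z n))\<^sup>2 \<le> D * (expectation (Z n))\<^sup>2"
      using D by (intro mult_right_mono) auto
    with n have "1 / (4 * D) \<le> prob (A n)"
      unfolding A_def by (intro paley_zygmund sq D assms(1)) (use n in linarith)+
    with n show False by simp
  qed
  then show False by simp
qed

text \<open>If the means were unbounded, a subsequence with means tending to infinity would have \<open>E (Z\<^sup>2) \<le> 2 K (E Z)\<^sup>2\<close>.
Paley--Zygmund would then make \<open>Z\<close> exceed half its mean infinitely often with positive probability, against the
almost sure bound.\<close>

lemma (in prob_space) bounded_expectation_if_AE_bounded: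
  fixes Z :: "'i \<Rightarrow> 'a \<Rightarrow> real"
  assumes meas: "\<And>n. Z n \<in> borel_measurable M"
    and sq: "\<And>n. integrable M (\<lambda>\<omega>. (Z n \<omega>)\<^sup>2)"
    and moment: "\<And>n. expectation (\<lambda>\<omega>. (Z n \<omega>)\<^sup>2) \<le> K * (expectation (Z n) + (expectation (Z n))\<^sup>2)"
    and bounded: "AE \<omega> in M. \<exists>B. \<forall>n. Z n \<omega> \<le> B"
    and K: "0 \<le> K"
  shows "\<exists>B. \<forall>n. expectation (Z n) \<le> B"
proof (rule ccontr)
  assume "\<not> ?thesis"
  then have "\<forall>k. \<exists>n. real k + 1 < expectation (Z n)" by (meson not_le)
  then obtain s where s: "\<And>k. real k + 1 < expectation (Z (s k))" by metis
  have "\<not> (AE \<omega> in M. \<forall>\<^sub>F k in sequentially. Z (s k) \<omega> \<le> expectation (Z (s k)) / 2)"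
  proof (rule paley_zygmund_frequently[OF meas sq, where C="2 * K"])
    have "0 < expectation (Z (s k)) \<and>
      expectation (\<lambda>\<omega>. (Z (s k) \<omega>)\<^sup>2) \<le> 2 * K * (expectation (Z (s k)))\<^sup>2" for k
    proof
      let ?m = "expectation (Z (s k))"
      have m: "1 \<le> ?m" using s[of k] by linarith
      then show "0 < ?m" by simp
      have "?m \<le> ?m\<^sup>2" using m by (simp add: power2_eq_square)
      then have "K * (?m + ?m\<^sup>2) \<le> K * (2 * ?m\<^sup>2)" using K by (intro mult_left_mono) auto
      then show "expectation (\<lambda>\<omega>. (Z (s k) \<omega>)\<^sup>2) \<le> 2 * K * ?m\<^sup>2"
        using moment[of "s k"] by simp
    qed
    then show "\<exists>\<^sub>F k in sequentially. 0 < expectation (Z (s k)) \<and>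
      expectation (\<lambda>\<omega>. (Z (s k) \<omega>)\<^sup>2) \<le> 2 * K * (expectation (Z (s k)))\<^sup>2"
      by (intro eventually_frequently) auto
  qed
  moreover have "AE \<omega> in M. \<forall>\<^sub>F k in sequentially. Z (s k) \<omega> \<le> expectation (Z (s k)) / 2"
    using bounded
  proof eventually_elim
    case (elim \<omega>)
    then obtain B where B: "\<And>n. Z n \<omega> \<le> B" by auto
    obtain k0 :: nat where k0: "2 * B \<le> real k0" using real_arch_simple by blast
    show ?case
    proof (rule eventually_sequentiallyI)
      fix k assume "k0 \<le> k"
      then have "2 * B \<le> expectation (Z (s k))"
        using k0 s[of k] by (simp add: order_trans[of "2*B" "real k0"]) 
      then show "Z (s k) \<omega> \<le> expectation (Z (s k)) / 2" using B[of "s k"] by linarith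
    qed
  qed
  ultimately show False by blast
qed

section \<open>Independent summands\<close>

lemma (in prob_space) integrable_square_if_bounded:
  fixes Z :: "'a \<Rightarrow> real"
  assumes "Z \<in> borel_measurable M" "\<And>\<omega>. \<omega> \<in> space M \<Longrightarrow> \<bar>Z \<omega>\<bar> \<le> B"
  shows "integrable M (\<lambda>\<omega>. (Z \<omega>)\<^sup>2)"
proof (rule integrable_const_bound[where B="B\<^sup>2"])
  have "(Z \<omega>)\<^sup>2 \<le> B\<^sup>2" if "\<omega> \<in> space M" for \<omega>
    using power_mono[OF assms(2)[OF that], of 2] by simp
  then show "AE \<omega> in M. norm ((Z \<omega>)\<^sup>2) \<le> B\<^sup>2" by simp
qed (use assms(1) in measurable)

text \<open>The mixed terms factor by independence and only the diagonal is new.\<close>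

lemma (in prob_space) indep_sum_second_moment:
  fixes W :: "'i \<Rightarrow> 'a \<Rightarrow> real"
  assumes fin: "finite J"
    and indep: "indep_vars (\<lambda>_. borel) W J"
    and bound: "\<And>j \<omega>. j \<in> J \<Longrightarrow> \<omega> \<in> space M \<Longrightarrow> \<bar>W j \<omega>\<bar> \<le> B"
  shows "expectation (\<lambda>\<omega>. (\<Sum>j\<in>J. W j \<omega>)\<^sup>2)
    \<le> (\<Sum>j\<in>J. expectation (W j))\<^sup>2 + (\<Sum>j\<in>J. expectation (\<lambda>\<omega>. (W j \<omega>)\<^sup>2))"
  using assms
proof (induction J rule: finite_induct)
  case empty
  then show ?case by simp
next
  case (insert k J)
  have indJ: "indep_vars (\<lambda>_. borel) W J" using insert.prems(1) by (rule indep_vars_subset) auto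
  have [measurable]: "W j \<in> borel_measurable M" if "j \<in> insert k J" for j
    using insert.prems(1) that by (auto simp: indep_vars_def)
  note [measurable] = this[of k, simplified]
  define S where "S \<omega> = (\<Sum>j\<in>J. W j \<omega>)" for \<omega>
  have Sm[measurable]: "S \<in> borel_measurable M" unfolding S_def
    using \<open>\<And>j. j \<in> insert k J \<Longrightarrow> W j \<in> borel_measurable M\<close> by (intro borel_measurable_sum) auto
  have iW: "integrable M (W j)" if "j \<in> insert k J" for j
    using that insert.prems(2) \<open>\<And>j. j \<in> insert k J \<Longrightarrow> W j \<in> borel_measurable M\<close>
    by (intro integrable_const_bound[where B=B]) auto
  have SB: "\<bar>S \<omega>\<bar> \<le> real (card J) * B" if "\<omega> \<in> space M" for \<omega>
    unfolding S_def using that insert.prems(2)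
    by (intro order_trans[OF sum_abs] sum_bounded_above) auto
  have iS: "integrable M S"
    using SB by (intro integrable_const_bound[where B="real (card J) * B"]) auto
  have iS2: "integrable M (\<lambda>\<omega>. (S \<omega>)\<^sup>2)"
    using SB by (intro integrable_square_if_bounded[OF Sm])
  have iW2: "integrable M (\<lambda>\<omega>. (W k \<omega>)\<^sup>2)"
    using insert.prems(2) by (intro integrable_square_if_bounded[where B=B]) auto
  have iv: "indep_var borel (W k) borel S"
    unfolding S_def by (intro indep_vars_sum insert)
  have prod: "expectation (\<lambda>\<omega>. W k \<omega> * S \<omega>) = expectation (W k) * expectation S"
    and iWS: "integrable M (\<lambda>\<omega>. W k \<omega> * S \<omega>)"
    using indep_var_lebesgue_integral[OF iv] indep_var_integrable[OF iv] iW iS by auto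
  have ES: "expectation S = (\<Sum>j\<in>J. expectation (W j))"
    unfolding S_def using iW by (intro Bochner_Integration.integral_sum) auto
  have "expectation (\<lambda>\<omega>. (\<Sum>j\<in>insert k J. W j \<omega>)\<^sup>2)
      = expectation (\<lambda>\<omega>. (W k \<omega>)\<^sup>2 + 2 * (W k \<omega> * S \<omega>) + (S \<omega>)\<^sup>2)"
    using insert by (simp add: S_def power2_sum algebra_simps)
  also have "\<dots> = expectation (\<lambda>\<omega>. (W k \<omega>)\<^sup>2) + 2 * (expectation (W k) * expectation S)
      + expectation (\<lambda>\<omega>. (S \<omega>)\<^sup>2)"
    using iW2 iWS iS2 by (simp add: prod)
  also have "\<dots> \<le> expectation (\<lambda>\<omega>. (W k \<omega>)\<^sup>2) + 2 * (expectation (W k) * expectation S)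
      + ((expectation S)\<^sup>2 + (\<Sum>j\<in>J. expectation (\<lambda>\<omega>. (W j \<omega>)\<^sup>2)))"
    using insert.IH[OF indJ] insert.prems(2) by (simp add: S_def[symmetric] ES)
  also have "\<dots> \<le> (expectation (W k) + expectation S)\<^sup>2 + (\<Sum>j\<in>insert k J. expectation (\<lambda>\<omega>. (W j \<omega>)\<^sup>2))"
    using insert.hyps by (simp add: power2_sum algebra_simps)
  finally show ?case using insert.hyps by (simp add: ES)
qed

lemma (in prob_space) indep_unit_sum_second_moment:
  fixes W :: "'i \<Rightarrow> 'a \<Rightarrow> real"
  assumes fin: "finite J"
    and indep: "indep_vars (\<lambda>_. borel) W J"
    and unit: "\<And>j \<omega>. j \<in> J \<Longrightarrow> \<omega> \<in> space M \<Longrightarrow> 0 \<le> W j \<omega> \<and> W j \<omega> \<le> 1"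
  shows "expectation (\<lambda>\<omega>. (\<Sum>j\<in>J. W j \<omega>)\<^sup>2)
    \<le> (\<Sum>j\<in>J. expectation (W j)) + (\<Sum>j\<in>J. expectation (W j))\<^sup>2"
proof -
  have m: "W j \<in> borel_measurable M" if "j \<in> J" for j
    using indep that by (auto simp: indep_vars_def)
  have "expectation (\<lambda>\<omega>. (\<Sum>j\<in>J. W j \<omega>)\<^sup>2)
    \<le> (\<Sum>j\<in>J. expectation (W j))\<^sup>2 + (\<Sum>j\<in>J. expectation (\<lambda>\<omega>. (W j \<omega>)\<^sup>2))"
    using unit by (intro indep_sum_second_moment[where B=1] fin indep) fastforce
  also have "(\<Sum>j\<in>J. expectation (\<lambda>\<omega>. (W j \<omega>)\<^sup>2)) \<le> (\<Sum>j\<in>J. expectation (W j))"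
  proof (intro sum_mono integral_mono)
    fix j assume j: "j \<in> J"
    show "integrable M (\<lambda>\<omega>. (W j \<omega>)\<^sup>2)" "integrable M (W j)"
      using m[OF j] unit[OF j]
      by (auto intro!: integrable_const_bound[where B=1] simp: power_le_one)
    show "(W j \<omega>)\<^sup>2 \<le> W j \<omega>" if "\<omega> \<in> space M" for \<omega>
      using unit[OF j that] by (simp add: power2_eq_square mult_left_le_one_le)
  qed
  finally show ?thesis by simp
qed

text \<open>The bounded case of Kolmogorov's three-series theorem for nonnegative terms. Applied to indicators of
independent events it is the second Borel--Cantelli lemma.\<close>

lemma (in prob_space) indep_unit_series:
  fixes W :: "nat \<Rightarrow> 'a \<Rightarrow> real"
  assumes indep: "indep_vars (\<lambda>_. borel) W UNIV"
    and unit: "\<And>j \<omega>. \<omega> \<in> space M \<Longrightarrow> 0 \<le> W j \<omega> \<and> W j \<omega> \<le> 1"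
    and conv: "AE \<omega> in M. (\<Sum>j. ennreal (W j \<omega>)) < \<infinity>"
  shows "(\<Sum>j. \<integral>\<^sup>+\<omega>. ennreal (W j \<omega>) \<partial>M) < \<infinity>"
proof -
  have [measurable]: "W j \<in> borel_measurable M" for j
    using indep by (auto simp: indep_vars_def)
  have iW: "integrable M (W j)" for j
    using unit by (intro integrable_const_bound[where B=1]) auto
  define Z where "Z n \<omega> = (\<Sum>j<n. W j \<omega>)" for n \<omega>
  have EZ: "expectation (Z n) = (\<Sum>j<n. expectation (W j))" for n
    unfolding Z_def using iW by (intro Bochner_Integration.integral_sum) auto
  have "\<exists>B. \<forall>n. expectation (Z n) \<le> B"
  proof (rule bounded_expectation_if_AE_bounded[where K=1])
    show "Z n \<in> borel_measurable M" for n unfolding Z_def by measurable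
    show "integrable M (\<lambda>\<omega>. (Z n \<omega>)\<^sup>2)" for n
    proof (rule integrable_const_bound[where B="(real n)\<^sup>2"])
      have "0 \<le> Z n \<omega> \<and> Z n \<omega> \<le> real n" if "\<omega> \<in> space M" for \<omega>
        using unit[OF that] sum_mono[of "{..<n}" "\<lambda>j. W j \<omega>" "\<lambda>_. 1"] by (auto simp: Z_def intro!: sum_nonneg)
      then show "AE \<omega> in M. norm ((Z n \<omega>)\<^sup>2) \<le> (real n)\<^sup>2" by (auto intro!: power_mono)
    qed (simp add: Z_def)
    show "expectation (\<lambda>\<omega>. (Z n \<omega>)\<^sup>2) \<le> 1 * (expectation (Z n) + (expectation (Z n))\<^sup>2)" for n
      unfolding EZ unfolding Z_def mult_1
      by (intro indep_unit_sum_second_moment indep_vars_subset[OF indep]) (use unit in auto)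
    show "AE \<omega> in M. \<exists>B. \<forall>n. Z n \<omega> \<le> B"
      using conv AE_space unfolding Z_def
      by eventually_elim (use unit in \<open>auto intro!: sum_ennreal_le_if_suminf_finite\<close>)
  qed simp
  then obtain B where B: "\<And>n. (\<Sum>j<n. expectation (W j)) \<le> B" by (auto simp: EZ)
  have "(\<Sum>j. ennreal (expectation (W j))) < \<infinity>"
    using B unit by (intro suminf_ennreal_finite_if_sum_le) (auto intro!: integral_nonneg_AE)
  moreover have "(\<integral>\<^sup>+\<omega>. ennreal (W j \<omega>) \<partial>M) = ennreal (expectation (W j))" for j
    using iW unit by (intro nn_integral_eq_integral) auto
  ultimately show ?thesis by simp
qed

section \<open>Kernels evaluated at two independent sequences\<close>

lemma sum_nn_integral_eq_ennreal_sum: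
  fixes g :: "'i \<Rightarrow> 'a \<Rightarrow> real"
  assumes "\<And>j. integrable M (g j)" "\<And>j \<omega>. 0 \<le> g j \<omega>"
  shows "(\<Sum>j\<in>J. \<integral>\<^sup>+\<omega>. ennreal (g j \<omega>) \<partial>M) = ennreal (\<Sum>j\<in>J. \<integral>\<omega>. g j \<omega> \<partial>M)"
proof -
  have "(\<integral>\<^sup>+\<omega>. ennreal (g j \<omega>) \<partial>M) = ennreal (\<integral>\<omega>. g j \<omega> \<partial>M)" for j
    using assms by (intro nn_integral_eq_integral) auto
  moreover have "0 \<le> (\<integral>\<omega>. g j \<omega> \<partial>M)" for j
    using assms by (intro integral_nonneg_AE) auto
  ultimately show ?thesis by simp
qed

text \<open>The two sequences live on separate probability spaces, so that freezing one of them is taking a section of the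
product. The situation is symmetric under exchanging them, and every statement about columns is obtained from
the one about rows by \<open>swap\<close>.\<close>

locale two_sample_kernel = P: prob_space P + Q: prob_space Q
  for P :: "'p measure" and Q :: "'q measure" +
  fixes E :: "'e measure" and F :: "'f measure"
    and X :: "nat \<Rightarrow> 'p \<Rightarrow> 'e" and Y :: "nat \<Rightarrow> 'q \<Rightarrow> 'f"
    and f :: "nat \<Rightarrow> nat \<Rightarrow> 'e \<times> 'f \<Rightarrow> real"
  assumes X_indep: "P.indep_vars (\<lambda>_. E) X UNIV"
    and Y_indep: "Q.indep_vars (\<lambda>_. F) Y UNIV"
    and f_measurable [measurable]: "\<And>i j. f i j \<in> borel_measurable (E \<Otimes>\<^sub>M F)"
    and f_nonneg: "\<And>i j z. 0 \<le> f i j z"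
    and f_le_1: "\<And>i j z. f i j z \<le> 1"
begin

lemma X_measurable [measurable]: "X i \<in> measurable P E"
  using X_indep by (auto simp: P.indep_vars_def)

lemma Y_measurable [measurable]: "Y j \<in> measurable Q F"
  using Y_indep by (auto simp: Q.indep_vars_def)

sublocale PQ: pair_prob_space P Q ..

definition row_mean :: "nat \<Rightarrow> 'e \<Rightarrow> ennreal" where
  "row_mean i x = (\<Sum>j. \<integral>\<^sup>+\<omega>'. ennreal (f i j (x, Y j \<omega>')) \<partial>Q)"

definition col_mean :: "nat \<Rightarrow> 'f \<Rightarrow> ennreal" where
  "col_mean j y = (\<Sum>i. \<integral>\<^sup>+\<omega>. ennreal (f i j (X i \<omega>, y)) \<partial>P)"

definition total :: "'p \<Rightarrow> 'q \<Rightarrow> ennreal" where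
  "total \<omega> \<omega>' = (\<Sum>i. \<Sum>j. ennreal (f i j (X i \<omega>, Y j \<omega>')))"

lemma row_mean_measurable [measurable]: "row_mean i \<in> borel_measurable E"
  unfolding row_mean_def by measurable

lemma col_mean_measurable [measurable]: "col_mean j \<in> borel_measurable F"
  unfolding col_mean_def by measurable

lemma total_measurable [measurable]: "(\<lambda>z. total (fst z) (snd z)) \<in> borel_measurable (P \<Otimes>\<^sub>M Q)"
  unfolding total_def by measurable

lemma swap: "two_sample_kernel Q P F E Y X (\<lambda>j i z. f i j (snd z, fst z))"
  using X_indep Y_indep by unfold_locales (auto simp: f_nonneg f_le_1)

lemma row_indep:
  assumes "x \<in> space E"
  shows "Q.indep_vars (\<lambda>_. borel) (\<lambda>j \<omega>'. f i j (x, Y j \<omega>')) UNIV"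
  using assms by (intro Q.indep_vars_compose2[OF Y_indep, of "\<lambda>j y. f i j (x, y)"]) measurable

text \<open>A row with mean above 1 has, by Paley--Zygmund applied to a long enough partial sum, a sum of at least 1/2 with
probability bounded below. Infinitely many such rows are impossible because the row sums tend to 0 almost surely.\<close>

lemma row_means_if_finite:
  assumes x: "\<And>i. x i \<in> space E"
    and fin: "AE \<omega>' in Q. (\<Sum>i. \<Sum>j. ennreal (f i j (x i, Y j \<omega>'))) < \<infinity>"
  shows "row_mean i (x i) < \<infinity>" "\<forall>\<^sub>F i in sequentially. row_mean i (x i) \<le> 1"
proof -
  note [measurable] = x
  have ind: "Q.indep_vars (\<lambda>_. borel) (\<lambda>j \<omega>'. f i j (x i, Y j \<omega>')) UNIV" for i
    by (rule row_indep[OF x])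
  have fin_row: "AE \<omega>' in Q. (\<Sum>j. ennreal (f i j (x i, Y j \<omega>'))) < \<infinity>" for i
    using fin
  proof eventually_elim
    case (elim \<omega>')
    show ?case
      using order_le_less_trans[OF sum_le_suminf[of "\<lambda>i. \<Sum>j. ennreal (f i j (x i, Y j \<omega>'))" "{i}"] elim]
      by auto
  qed
  show *: "row_mean i (x i) < \<infinity>" for i
    unfolding row_mean_def
    by (rule Q.indep_unit_series[OF ind _ fin_row]) (simp add: f_nonneg f_le_1)
  show "\<forall>\<^sub>F i in sequentially. row_mean i (x i) \<le> 1"
  proof (rule ccontr)
    assume "\<not> ?thesis"
    then have freq: "\<exists>\<^sub>F i in sequentially. 1 < row_mean i (x i)"
      by (simp add: not_eventually not_le)
    define m where "m i j = Q.expectation (\<lambda>\<omega>'. f i j (x i, Y j \<omega>'))" for i j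
    have m0: "0 \<le> m i j" for i j unfolding m_def by (intro integral_nonneg_AE) (simp add: f_nonneg)
    have int: "integrable Q (\<lambda>\<omega>'. f i j (x i, Y j \<omega>'))" for i j
      by (intro Q.integrable_const_bound[where B=1]) (auto simp: f_nonneg f_le_1)
    have rm: "row_mean i (x i) = (\<Sum>j. ennreal (m i j))" for i
      unfolding row_mean_def m_def using int
      by (intro suminf_cong nn_integral_eq_integral) (auto simp: f_nonneg)
    have "\<exists>k. 1 < row_mean i (x i) \<longrightarrow> 1 < (\<Sum>j<k. m i j)" for i
    proof (cases "1 < row_mean i (x i)")
      case True
      then have "\<exists>k. 1 < (\<Sum>j<k. ennreal (m i j))"
        unfolding rm by (subst (asm) suminf_eq_SUP) (simp add: less_SUP_iff)
      then show ?thesis using m0 by (auto simp: ennreal_less_iff sum_nonneg simp flip: ennreal_1)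
    qed auto
    then obtain k where k: "\<And>i. 1 < row_mean i (x i) \<Longrightarrow> 1 < (\<Sum>j<k i. m i j)" by metis
    \<comment> \<open>the empty sum is used for the other rows, so that the comparison with half the mean is trivial there\<close>
    define n where "n i = (if 1 < row_mean i (x i) then k i else 0)" for i
    define Z where "Z i \<omega>' = (\<Sum>j<n i. f i j (x i, Y j \<omega>'))" for i \<omega>'
    have Zm[measurable]: "Z i \<in> borel_measurable Q" for i unfolding Z_def by measurable
    have EZ: "Q.expectation (Z i) = (\<Sum>j<n i. m i j)" for i
      unfolding Z_def m_def using int by (intro Bochner_Integration.integral_sum) auto
    have "\<not> (AE \<omega>' in Q. \<forall>\<^sub>F i in sequentially. Z i \<omega>' \<le> Q.expectation (Z i) / 2)"
    proof (rule Q.paley_zygmund_frequently[where C=2])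
      show "integrable Q (\<lambda>\<omega>'. (Z i \<omega>')\<^sup>2)" for i
      proof (rule Q.integrable_square_if_bounded[OF Zm, where B="real (n i)"])
        have "\<bar>Z i \<omega>'\<bar> \<le> (\<Sum>j<n i. 1)" for \<omega>'
          unfolding Z_def by (intro order_trans[OF sum_abs] sum_mono) (simp add: f_nonneg f_le_1)
        then show "\<bar>Z i \<omega>'\<bar> \<le> real (n i)" for \<omega>' by simp
      qed
      have "0 < Q.expectation (Z i) \<and>
          Q.expectation (\<lambda>\<omega>'. (Z i \<omega>')\<^sup>2) \<le> 2 * (Q.expectation (Z i))\<^sup>2" if "1 < row_mean i (x i)" for i
      proof -
        have gt: "1 < Q.expectation (Z i)" using k[OF that] that by (simp add: EZ n_def)
        have "Q.expectation (\<lambda>\<omega>'. (Z i \<omega>')\<^sup>2) \<le> Q.expectation (Z i) + (Q.expectation (Z i))\<^sup>2"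
          unfolding EZ unfolding Z_def m_def
          by (intro Q.indep_unit_sum_second_moment Q.indep_vars_subset[OF ind]) (auto simp: f_nonneg f_le_1)
        moreover have "Q.expectation (Z i) \<le> (Q.expectation (Z i))\<^sup>2"
          using gt by (simp add: power2_eq_square)
        ultimately show ?thesis using gt by simp
      qed
      then show "\<exists>\<^sub>F i in sequentially. 0 < Q.expectation (Z i) \<and>
          Q.expectation (\<lambda>\<omega>'. (Z i \<omega>')\<^sup>2) \<le> 2 * (Q.expectation (Z i))\<^sup>2"
        by (intro frequently_mono[OF _ freq] allI impI)
    qed simp
    moreover have "AE \<omega>' in Q. \<forall>\<^sub>F i in sequentially. Z i \<omega>' \<le> Q.expectation (Z i) / 2"
      using fin
    proof eventually_elim
      case (elim \<omega>')
      have "\<forall>\<^sub>F i in sequentially. (\<Sum>j. ennreal (f i j (x i, Y j \<omega>'))) < ennreal (1 / 2)"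
        using tendsto_0_if_suminf_ennreal_finite[OF elim] by (rule order_tendstoD) (subst ennreal_less_zero_iff, simp)
      then show ?case
      proof eventually_elim
        case (elim i)
        show "Z i \<omega>' \<le> Q.expectation (Z i) / 2"
        proof (cases "1 < row_mean i (x i)")
          case True
          have "ennreal (Z i \<omega>') = (\<Sum>j<n i. ennreal (f i j (x i, Y j \<omega>')))"
            unfolding Z_def by (simp add: f_nonneg)
          also have "\<dots> \<le> (\<Sum>j. ennreal (f i j (x i, Y j \<omega>')))" by (intro sum_le_suminf) auto
          also note elim
          finally have "ennreal (Z i \<omega>') < ennreal (1 / 2)" .
          moreover have "0 \<le> Z i \<omega>'" unfolding Z_def by (intro sum_nonneg f_nonneg)
          ultimately have "Z i \<omega>' < 1 / 2" using ennreal_less_iff by blast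
          then show ?thesis using k[OF True] True by (simp add: EZ n_def)
        next
          case False
          then show ?thesis by (simp add: EZ Z_def n_def)
        qed
      qed
    qed
    ultimately show False by blast
  qed
qed

text \<open>For almost every \<open>\<omega>\<close> the previous lemma applies to the points \<open>X i \<omega>\<close>. Only finitely many of the independent
events \<open>1 < row_mean i (X i \<omega>)\<close> occur almost surely, so their probabilities are summable.\<close>

lemma row_conditions_if_total_finite:
  assumes fin: "AE \<omega> in P. AE \<omega>' in Q. total \<omega> \<omega>' < \<infinity>"
  shows "AE \<omega> in P. row_mean i (X i \<omega>) < \<infinity>"
    and "(\<Sum>i. emeasure P {\<omega> \<in> space P. 1 < row_mean i (X i \<omega>)}) < \<infinity>"
proof -
  have *: "AE \<omega> in P. (\<forall>i. row_mean i (X i \<omega>) < \<infinity>) \<and> (\<forall>\<^sub>F i in sequentially. row_mean i (X i \<omega>) \<le> 1)"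
    using fin AE_space
  proof eventually_elim
    case (elim \<omega>)
    have "\<And>i. X i \<omega> \<in> space E" using elim(2) by (rule measurable_space[OF X_measurable])
    from row_means_if_finite[OF this elim(1)[unfolded total_def]] show ?case by blast
  qed
  then show "AE \<omega> in P. row_mean i (X i \<omega>) < \<infinity>" by eventually_elim blast
  define W where "W i \<omega> = indicat_real {x. 1 < row_mean i x} (X i \<omega>)" for i \<omega>
  have "(\<Sum>i. \<integral>\<^sup>+\<omega>. ennreal (W i \<omega>) \<partial>P) < \<infinity>"
  proof (rule P.indep_unit_series)
    show "P.indep_vars (\<lambda>_. borel) W UNIV" unfolding W_def
      by (intro P.indep_vars_compose2[OF X_indep, of "\<lambda>i. indicat_real {x. 1 < row_mean i x}"]) measurable
    show "0 \<le> W i \<omega> \<and> W i \<omega> \<le> 1" for i \<omega> by (simp add: W_def indicator_def)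
    show "AE \<omega> in P. (\<Sum>i. ennreal (W i \<omega>)) < \<infinity>"
      using *
    proof eventually_elim
      case (elim \<omega>)
      show ?case
      proof (rule suminf_ennreal_finite_eventually_eq[where v="\<lambda>_. 0"])
        show "\<forall>\<^sub>F i in sequentially. ennreal (W i \<omega>) = 0"
          using elim[THEN conjunct2] by eventually_elim (simp add: W_def)
      qed auto
    qed
  qed
  moreover have "(\<integral>\<^sup>+\<omega>. ennreal (W i \<omega>) \<partial>P) = emeasure P {\<omega> \<in> space P. 1 < row_mean i (X i \<omega>)}" for i
  proof -
    have "(\<integral>\<^sup>+\<omega>. ennreal (W i \<omega>) \<partial>P) = (\<integral>\<^sup>+\<omega>. indicator {\<omega> \<in> space P. 1 < row_mean i (X i \<omega>)} \<omega> \<partial>P)"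
      by (intro nn_integral_cong) (simp add: W_def indicator_def)
    then show ?thesis by (simp add: nn_integral_indicator)
  qed
  ultimately show "(\<Sum>i. emeasure P {\<omega> \<in> space P. 1 < row_mean i (X i \<omega>)}) < \<infinity>" by simp
qed

definition entry :: "nat \<Rightarrow> nat \<Rightarrow> 'p \<Rightarrow> 'q \<Rightarrow> real" where
  "entry i j \<omega> \<omega>' = f i j (X i \<omega>, Y j \<omega>')"

lemma entry_measurable [measurable]: "case_prod (entry i j) \<in> borel_measurable (P \<Otimes>\<^sub>M Q)"
  unfolding entry_def[abs_def] by measurable

lemma entry_nonneg: "0 \<le> entry i j \<omega> \<omega>'" and entry_le_1: "entry i j \<omega> \<omega>' \<le> 1"
  by (simp_all add: entry_def f_nonneg f_le_1)

lemma entry_integrable: "integrable (P \<Otimes>\<^sub>M Q) (case_prod (entry i j))"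
proof (rule PQ.integrable_const_bound[where B=1])
  show "AE z in P \<Otimes>\<^sub>M Q. norm (case_prod (entry i j) z) \<le> 1"
    by (rule AE_I2) (simp add: case_prod_unfold entry_nonneg entry_le_1)
qed (rule entry_measurable)

lemma entry_section_integrable:
  assumes "\<omega> \<in> space P" shows "integrable Q (entry i j \<omega>)"
proof (intro Q.integrable_const_bound[where B=1])
  show "entry i j \<omega> \<in> borel_measurable Q"
    using measurable_Pair2[OF entry_measurable assms] by simp
qed (auto simp: entry_nonneg entry_le_1)

text \<open>For a fixed second argument the column sum is a sum of independent terms in \<open>[0, 1]\<close> with mean at most 1, so
the square of the mean is dominated by the mean.\<close>

lemma column_sum_section_second_moment:
  assumes col: "\<And>j y. y \<in> space F \<Longrightarrow> col_mean j y \<le> 1" and \<omega>': "\<omega>' \<in> space Q"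
  shows "P.expectation (\<lambda>\<omega>. (\<Sum>i<n. entry i j \<omega> \<omega>')\<^sup>2) \<le> 2 * P.expectation (\<lambda>\<omega>. \<Sum>i<n. entry i j \<omega> \<omega>')"
proof -
  interpret S: two_sample_kernel Q P F E Y X "\<lambda>j i z. f i j (snd z, fst z)" by (rule swap)
  have y: "Y j \<omega>' \<in> space F" using \<omega>' by (rule measurable_space[OF Y_measurable])
  have ind: "P.indep_vars (\<lambda>_. borel) (\<lambda>i \<omega>. entry i j \<omega> \<omega>') UNIV"
    using S.row_indep[OF y, of j] by (simp add: entry_def)
  have int: "integrable P (\<lambda>\<omega>. entry i j \<omega> \<omega>')" for i
    using S.entry_section_integrable[OF \<omega>', of j i] by (simp add: S.entry_def[abs_def] entry_def)
  define m where "m = (\<Sum>i<n. P.expectation (\<lambda>\<omega>. entry i j \<omega> \<omega>'))"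
  have m: "m = P.expectation (\<lambda>\<omega>. \<Sum>i<n. entry i j \<omega> \<omega>')"
    unfolding m_def using int by (intro Bochner_Integration.integral_sum[symmetric]) auto
  have m0: "0 \<le> m" unfolding m_def by (intro sum_nonneg integral_nonneg_AE AE_I2 entry_nonneg)
  have "ennreal m = (\<Sum>i<n. \<integral>\<^sup>+\<omega>. ennreal (f i j (X i \<omega>, Y j \<omega>')) \<partial>P)"
    unfolding m_def by (subst sum_nn_integral_eq_ennreal_sum) (use int in \<open>simp_all add: entry_def f_nonneg\<close>)
  also have "\<dots> \<le> col_mean j (Y j \<omega>')"
    unfolding col_mean_def by (intro sum_le_suminf) auto
  also have "\<dots> \<le> 1" by (rule col[OF y])
  finally have m1: "m \<le> 1" using m0 by (simp flip: ennreal_1 add: ennreal_le_iff)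
  have "P.expectation (\<lambda>\<omega>. (\<Sum>i<n. entry i j \<omega> \<omega>')\<^sup>2) \<le> m + m\<^sup>2"
    unfolding m_def
    by (intro P.indep_unit_sum_second_moment P.indep_vars_subset[OF ind]) (auto simp: entry_nonneg entry_le_1)
  also have "m\<^sup>2 \<le> m" using m0 m1 by (simp add: power2_eq_square mult_left_le)
  finally show ?thesis by (simp add: m)
qed

text \<open>For fixed \<open>\<omega>\<close> the column sums \<open>W j\<close> are independent, so the conditional second moment of \<open>Z n\<close> is at most the
squared conditional mean plus \<open>\<Sum>j<n. E ((W j)\<^sup>2)\<close>. The conditional mean is the sum of the \<open>R i \<omega>\<close>, which are independent
and, by the bound on the row means, lie in \<open>[0, 1]\<close>; its second moment is at most \<open>E Z + (E Z)\<^sup>2\<close>. Integrating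
\<open>(W j)\<^sup>2\<close> in the other order and using the bound on the column means contributes at most \<open>2 E Z\<close>.\<close>

lemma square_sum_second_moment:
  assumes row: "\<And>i x. x \<in> space E \<Longrightarrow> row_mean i x \<le> 1"
    and col: "\<And>j y. y \<in> space F \<Longrightarrow> col_mean j y \<le> 1"
  defines "Z \<equiv> \<lambda>n z. \<Sum>i<n. \<Sum>j<n. entry i j (fst z) (snd z)"
  shows "PQ.expectation (\<lambda>z. (Z n z)\<^sup>2) \<le> 3 * (PQ.expectation (Z n) + (PQ.expectation (Z n))\<^sup>2)"
proof -
  define W where "W j \<omega> \<omega>' = (\<Sum>i<n. entry i j \<omega> \<omega>')" for j \<omega> \<omega>'
  have Wm[measurable]: "case_prod (W j) \<in> borel_measurable (P \<Otimes>\<^sub>M Q)" for j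
    unfolding W_def by measurable
  have W_bound: "\<bar>W j \<omega> \<omega>'\<bar> \<le> real n" for j \<omega> \<omega>'
  proof -
    have "\<bar>W j \<omega> \<omega>'\<bar> \<le> (\<Sum>i<n. 1)"
      unfolding W_def by (intro order_trans[OF sum_abs] sum_mono) (simp add: entry_nonneg entry_le_1)
    then show ?thesis by simp
  qed
  have ZW: "Z n (\<omega>, \<omega>') = (\<Sum>j<n. W j \<omega> \<omega>')" for \<omega> \<omega>'
    unfolding Z_def W_def fst_conv snd_conv by (rule sum.swap)
  have Z_bound: "\<bar>Z n (\<omega>, \<omega>')\<bar> \<le> real n * real n" for \<omega> \<omega>'
    unfolding ZW using sum_bounded_above[of "{..<n}" "\<lambda>j. \<bar>W j \<omega> \<omega>'\<bar>" "real n"] W_bound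
    by (intro order_trans[OF sum_abs]) auto
  have Z_bound': "\<bar>Z n z\<bar> \<le> real n * real n" for z using Z_bound[of "fst z" "snd z"] by simp
  have Zm[measurable]: "Z n \<in> borel_measurable (P \<Otimes>\<^sub>M Q)" unfolding Z_def by measurable
  have iZ: "integrable (P \<Otimes>\<^sub>M Q) (Z n)"
    by (rule PQ.integrable_const_bound[where B="real n * real n"]) (simp_all add: Z_bound')
  have iZ2: "integrable (P \<Otimes>\<^sub>M Q) (\<lambda>z. (Z n z)\<^sup>2)"
    by (rule PQ.integrable_square_if_bounded[OF Zm, where B="real n * real n"]) (rule Z_bound')
  have iW: "integrable (P \<Otimes>\<^sub>M Q) (case_prod (W j))" for j
    by (rule PQ.integrable_const_bound[where B="real n"]) (simp_all add: W_bound case_prod_unfold)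
  have iW2: "integrable (P \<Otimes>\<^sub>M Q) (case_prod (\<lambda>\<omega> \<omega>'. (W j \<omega> \<omega>')\<^sup>2))" for j
    using PQ.integrable_square_if_bounded[OF Wm, where B="real n", of j] W_bound by (auto simp: case_prod_unfold)
  define R where "R i \<omega> = (\<Sum>j<n. Q.expectation (entry i j \<omega>))" for i \<omega>
  have R_ind: "P.indep_vars (\<lambda>_. borel) R UNIV"
    unfolding R_def entry_def
    by (intro P.indep_vars_compose2[OF X_indep, of "\<lambda>i x. \<Sum>j<n. Q.expectation (\<lambda>\<omega>'. f i j (x, Y j \<omega>'))"])
      measurable
  have R_unit: "0 \<le> R i \<omega> \<and> R i \<omega> \<le> 1" if \<omega>: "\<omega> \<in> space P" for i \<omega>
  proof
    show R0: "0 \<le> R i \<omega>"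
      unfolding R_def by (intro sum_nonneg integral_nonneg_AE AE_I2 entry_nonneg)
    have "ennreal (R i \<omega>) = (\<Sum>j<n. \<integral>\<^sup>+\<omega>'. ennreal (f i j (X i \<omega>, Y j \<omega>')) \<partial>Q)"
      unfolding R_def using entry_section_integrable[OF \<omega>]
      by (subst sum_nn_integral_eq_ennreal_sum) (simp_all add: entry_def[abs_def] f_nonneg)
    also have "\<dots> \<le> row_mean i (X i \<omega>)"
      unfolding row_mean_def by (intro sum_le_suminf) auto
    also have "\<dots> \<le> 1" by (rule row[OF measurable_space[OF X_measurable \<omega>]])
    finally show "R i \<omega> \<le> 1" using R0 by (simp flip: ennreal_1 add: ennreal_le_iff)
  qed
  have iR: "integrable P (R i)" for i
    using R_ind R_unit by (intro P.integrable_const_bound[where B=1]) (auto simp: P.indep_vars_def)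
  have sumR: "Q.expectation (\<lambda>\<omega>'. Z n (\<omega>, \<omega>')) = (\<Sum>i<n. R i \<omega>)" if "\<omega> \<in> space P" for \<omega>
    unfolding Z_def R_def using entry_section_integrable[OF that]
    by (simp add: Bochner_Integration.integral_sum Bochner_Integration.integrable_sum)
  have EZ: "PQ.expectation (Z n) = (\<Sum>i<n. P.expectation (R i))"
    using PQ.integral_fst'[OF iZ] iR sumR
    by (simp cong: Bochner_Integration.integral_cong add: Bochner_Integration.integral_sum)
  have EW: "(\<Sum>j<n. P.expectation (\<lambda>\<omega>. Q.expectation (W j \<omega>))) = PQ.expectation (Z n)"
  proof -
    have "(\<Sum>j<n. P.expectation (\<lambda>\<omega>. Q.expectation (W j \<omega>))) = (\<Sum>j<n. PQ.expectation (case_prod (W j)))"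
      using PQ.integral_fst'[OF iW] by simp
    also have "\<dots> = PQ.expectation (\<lambda>z. \<Sum>j<n. case_prod (W j) z)"
      using iW by (intro Bochner_Integration.integral_sum[symmetric]) auto
    also have "\<dots> = PQ.expectation (Z n)"
      by (intro Bochner_Integration.integral_cong refl) (auto simp: ZW)
    finally show ?thesis .
  qed
  have sec: "Q.expectation (\<lambda>\<omega>'. (Z n (\<omega>, \<omega>'))\<^sup>2)
      \<le> (\<Sum>i<n. R i \<omega>)\<^sup>2 + (\<Sum>j<n. Q.expectation (\<lambda>\<omega>'. (W j \<omega> \<omega>')\<^sup>2))" if \<omega>: "\<omega> \<in> space P" for \<omega>
  proof -
    have x: "X i \<omega> \<in> space E" for i by (rule measurable_space[OF X_measurable \<omega>])
    have ind: "Q.indep_vars (\<lambda>_. borel) (\<lambda>j. W j \<omega>) UNIV"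
      unfolding W_def entry_def using x
      by (intro Q.indep_vars_compose2[OF Y_indep, of "\<lambda>j y. \<Sum>i<n. f i j (X i \<omega>, y)"]) measurable
    have "Q.expectation (\<lambda>\<omega>'. (\<Sum>j<n. W j \<omega> \<omega>')\<^sup>2)
        \<le> (\<Sum>j<n. Q.expectation (W j \<omega>))\<^sup>2 + (\<Sum>j<n. Q.expectation (\<lambda>\<omega>'. (W j \<omega> \<omega>')\<^sup>2))"
      by (rule Q.indep_sum_second_moment[where B="real n"])
        (auto intro: Q.indep_vars_subset[OF ind] W_bound)
    also have "(\<Sum>j<n. Q.expectation (W j \<omega>)) = (\<Sum>i<n. R i \<omega>)"
      unfolding W_def R_def using entry_section_integrable[OF \<omega>]
      by (subst sum.swap) (simp add: Bochner_Integration.integral_sum)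
    finally show ?thesis by (simp add: ZW)
  qed
  have iR2: "integrable P (\<lambda>\<omega>. (\<Sum>i<n. R i \<omega>)\<^sup>2)"
  proof (rule P.integrable_square_if_bounded[where B="real n"])
    show "(\<lambda>\<omega>. \<Sum>i<n. R i \<omega>) \<in> borel_measurable P" using iR by measurable
    show "\<bar>\<Sum>i<n. R i \<omega>\<bar> \<le> real n" if "\<omega> \<in> space P" for \<omega>
      using R_unit[OF that] sum_bounded_above[of "{..<n}" "\<lambda>i. \<bar>R i \<omega>\<bar>" 1]
      by (intro order_trans[OF sum_abs]) auto
  qed
  have iEW2: "integrable P (\<lambda>\<omega>. Q.expectation (\<lambda>\<omega>'. (W j \<omega> \<omega>')\<^sup>2))" for j
    using PQ.integrable_fst'[OF iW2[of j]] by simp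
  have "PQ.expectation (\<lambda>z. (Z n z)\<^sup>2) = P.expectation (\<lambda>\<omega>. Q.expectation (\<lambda>\<omega>'. (Z n (\<omega>, \<omega>'))\<^sup>2))"
    by (rule PQ.integral_fst'[OF iZ2, symmetric])
  also have "\<dots> \<le> P.expectation (\<lambda>\<omega>. (\<Sum>i<n. R i \<omega>)\<^sup>2 + (\<Sum>j<n. Q.expectation (\<lambda>\<omega>'. (W j \<omega> \<omega>')\<^sup>2)))"
    using iR2 iEW2 PQ.integrable_fst'[OF iZ2] sec by (intro integral_mono) auto
  also have "\<dots> = P.expectation (\<lambda>\<omega>. (\<Sum>i<n. R i \<omega>)\<^sup>2)
      + (\<Sum>j<n. P.expectation (\<lambda>\<omega>. Q.expectation (\<lambda>\<omega>'. (W j \<omega> \<omega>')\<^sup>2)))"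
    using iR2 iEW2 by simp
  also have "\<dots> \<le> (PQ.expectation (Z n) + (PQ.expectation (Z n))\<^sup>2) + 2 * PQ.expectation (Z n)"
  proof (rule add_mono)
    show "P.expectation (\<lambda>\<omega>. (\<Sum>i<n. R i \<omega>)\<^sup>2) \<le> PQ.expectation (Z n) + (PQ.expectation (Z n))\<^sup>2"
      unfolding EZ by (intro P.indep_unit_sum_second_moment P.indep_vars_subset[OF R_ind]) (use R_unit in auto)
    have "P.expectation (\<lambda>\<omega>. Q.expectation (\<lambda>\<omega>'. (W j \<omega> \<omega>')\<^sup>2))
        \<le> 2 * P.expectation (\<lambda>\<omega>. Q.expectation (W j \<omega>))" for j
    proof -
      have "P.expectation (\<lambda>\<omega>. Q.expectation (\<lambda>\<omega>'. (W j \<omega> \<omega>')\<^sup>2))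
          = Q.expectation (\<lambda>\<omega>'. P.expectation (\<lambda>\<omega>. (W j \<omega> \<omega>')\<^sup>2))"
        by (rule PQ.Fubini_integral[OF iW2, symmetric])
      also have "\<dots> \<le> Q.expectation (\<lambda>\<omega>'. 2 * P.expectation (\<lambda>\<omega>. W j \<omega> \<omega>'))"
      proof (rule integral_mono)
        show "integrable Q (\<lambda>\<omega>'. P.expectation (\<lambda>\<omega>. (W j \<omega> \<omega>')\<^sup>2))"
          using PQ.integrable_snd[OF iW2[of j]] by simp
        show "integrable Q (\<lambda>\<omega>'. 2 * P.expectation (\<lambda>\<omega>. W j \<omega> \<omega>'))"
          using PQ.integrable_snd[OF iW[of j]] by simp
        show "P.expectation (\<lambda>\<omega>. (W j \<omega> \<omega>')\<^sup>2) \<le> 2 * P.expectation (\<lambda>\<omega>. W j \<omega> \<omega>')"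
          if "\<omega>' \<in> space Q" for \<omega>'
          unfolding W_def by (rule column_sum_section_second_moment[OF col that])
      qed
      also have "\<dots> = 2 * P.expectation (\<lambda>\<omega>. Q.expectation (W j \<omega>))"
        using PQ.Fubini_integral[OF iW[of j]] by simp
      finally show ?thesis .
    qed
    then show "(\<Sum>j<n. P.expectation (\<lambda>\<omega>. Q.expectation (\<lambda>\<omega>'. (W j \<omega> \<omega>')\<^sup>2)))
        \<le> 2 * PQ.expectation (Z n)"
      unfolding EW[symmetric] sum_distrib_left by (intro sum_mono)
  qed
  also have "\<dots> \<le> 3 * (PQ.expectation (Z n) + (PQ.expectation (Z n))\<^sup>2)" by simp
  finally show ?thesis .
qed

lemma mean_finite_if_total_finite:
  assumes row: "\<And>i x. x \<in> space E \<Longrightarrow> row_mean i x \<le> 1"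
    and col: "\<And>j y. y \<in> space F \<Longrightarrow> col_mean j y \<le> 1"
    and fin: "AE z in P \<Otimes>\<^sub>M Q. total (fst z) (snd z) < \<infinity>"
  shows "(\<Sum>i. \<Sum>j. \<integral>\<^sup>+z. ennreal (entry i j (fst z) (snd z)) \<partial>(P \<Otimes>\<^sub>M Q)) < \<infinity>"
proof -
  define Z where "Z n z = (\<Sum>i<n. \<Sum>j<n. entry i j (fst z) (snd z))" for n z
  have Zm[measurable]: "Z n \<in> borel_measurable (P \<Otimes>\<^sub>M Q)" for n unfolding Z_def by measurable
  have int: "integrable (P \<Otimes>\<^sub>M Q) (\<lambda>z. entry i j (fst z) (snd z))" for i j
    using entry_integrable by (simp add: case_prod_unfold)
  have "\<exists>B. \<forall>n. PQ.expectation (Z n) \<le> B"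
  proof (rule PQ.bounded_expectation_if_AE_bounded[OF Zm])
    show "integrable (P \<Otimes>\<^sub>M Q) (\<lambda>z. (Z n z)\<^sup>2)" for n
    proof (rule PQ.integrable_square_if_bounded[OF Zm, where B="\<Sum>i<n. \<Sum>j<n. 1"])
      show "\<bar>Z n z\<bar> \<le> (\<Sum>i<n. \<Sum>j<n. 1)" for z
        unfolding Z_def by (intro order_trans[OF sum_abs] sum_mono) (simp add: entry_nonneg entry_le_1)
    qed
    show "PQ.expectation (\<lambda>z. (Z n z)\<^sup>2) \<le> 3 * (PQ.expectation (Z n) + (PQ.expectation (Z n))\<^sup>2)" for n
      unfolding Z_def by (rule square_sum_second_moment[OF row col])
    show "AE z in P \<Otimes>\<^sub>M Q. \<exists>B. \<forall>n. Z n z \<le> B"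
      using fin
      by eventually_elim
        (auto simp: Z_def total_def entry_def intro!: square_sums_le_if_suminf_finite f_nonneg)
  qed simp
  then obtain B where B: "\<And>n. PQ.expectation (Z n) \<le> B" by auto
  have "(\<Sum>i. \<Sum>j. ennreal (PQ.expectation (\<lambda>z. entry i j (fst z) (snd z)))) < \<infinity>"
  proof (rule suminf_suminf_finite_if_square_sums_le)
    show "(\<Sum>i<n. \<Sum>j<n. PQ.expectation (\<lambda>z. entry i j (fst z) (snd z))) \<le> B" for n
      using B[of n] int unfolding Z_def by simp
  qed (auto intro!: integral_nonneg_AE simp: entry_nonneg)
  moreover have "(\<integral>\<^sup>+z. ennreal (entry i j (fst z) (snd z)) \<partial>(P \<Otimes>\<^sub>M Q))
      = ennreal (PQ.expectation (\<lambda>z. entry i j (fst z) (snd z)))" for i j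
    using int by (intro nn_integral_eq_integral) (auto simp: entry_nonneg)
  ultimately show ?thesis by simp
qed

end

section \<open>Almost sure finiteness of the kernel sum\<close>

context two_sample_kernel begin

lemma AE_total_iff_iterated:
  "(AE z in P \<Otimes>\<^sub>M Q. total (fst z) (snd z) < \<infinity>) \<longleftrightarrow> (AE \<omega> in P. AE \<omega>' in Q. total \<omega> \<omega>' < \<infinity>)"
  "(AE z in P \<Otimes>\<^sub>M Q. total (fst z) (snd z) < \<infinity>) \<longleftrightarrow> (AE \<omega>' in Q. AE \<omega> in P. total \<omega> \<omega>' < \<infinity>)"
proof -
  have meas: "{z \<in> space (P \<Otimes>\<^sub>M Q). total (fst z) (snd z) < \<infinity>} \<in> sets (P \<Otimes>\<^sub>M Q)" by measurable
  show 1: "(AE z in P \<Otimes>\<^sub>M Q. total (fst z) (snd z) < \<infinity>) \<longleftrightarrow> (AE \<omega> in P. AE \<omega>' in Q. total \<omega> \<omega>' < \<infinity>)"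
    by (rule PQ.AE_pair_iff[OF meas, symmetric])
  show "(AE z in P \<Otimes>\<^sub>M Q. total (fst z) (snd z) < \<infinity>) \<longleftrightarrow> (AE \<omega>' in Q. AE \<omega> in P. total \<omega> \<omega>' < \<infinity>)"
    unfolding 1 by (rule PQ.AE_commute[OF meas])
qed

lemma AE_row_sum_finite:
  assumes "AE \<omega> in P. row_mean i (X i \<omega>) < \<infinity>"
  shows "AE z in P \<Otimes>\<^sub>M Q. (\<Sum>j. ennreal (entry i j (fst z) (snd z))) < \<infinity>"
proof (rule PQ.AE_pair_measure)
  show "AE \<omega> in P. AE \<omega>' in Q. (\<Sum>j. ennreal (entry i j (fst (\<omega>, \<omega>')) (snd (\<omega>, \<omega>')))) < \<infinity>"
    using assms AE_space
  proof eventually_elim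
    case (elim \<omega>)
    have [measurable]: "X i \<omega> \<in> space E" by (rule measurable_space[OF X_measurable elim(2)])
    have "(\<integral>\<^sup>+\<omega>'. (\<Sum>j. ennreal (f i j (X i \<omega>, Y j \<omega>'))) \<partial>Q) = row_mean i (X i \<omega>)"
      unfolding row_mean_def by (rule nn_integral_suminf) measurable
    then have "(\<integral>\<^sup>+\<omega>'. (\<Sum>j. ennreal (f i j (X i \<omega>, Y j \<omega>'))) \<partial>Q) \<noteq> \<infinity>" using elim(1) by simp
    then have "AE \<omega>' in Q. (\<Sum>j. ennreal (f i j (X i \<omega>, Y j \<omega>'))) \<noteq> \<infinity>"
      by (intro nn_integral_noteq_infinite) measurable
    then show ?case by (simp add: entry_def top.not_eq_extremum)
  qed
qed (simp add: entry_def)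

lemma AE_eventually_row_mean_le_1:
  assumes "(\<Sum>i. emeasure P {\<omega> \<in> space P. 1 < row_mean i (X i \<omega>)}) < \<infinity>"
  shows "AE \<omega> in P. \<forall>\<^sub>F i in sequentially. row_mean i (X i \<omega>) \<le> 1"
proof -
  have "AE \<omega> in P. \<forall>\<^sub>F i in sequentially. \<omega> \<in> space P - {\<omega> \<in> space P. 1 < row_mean i (X i \<omega>)}"
  proof (rule borel_cantelli_AE1)
    show "summable (\<lambda>i. P.prob {\<omega> \<in> space P. 1 < row_mean i (X i \<omega>)})"
      using assms by (intro summable_suminf_not_top) (auto simp: P.emeasure_eq_measure)
  qed (simp_all add: less_top[symmetric])
  then show ?thesis by eventually_elim (auto elim: eventually_mono)
qed

text \<open>By Borel--Cantelli almost surely only finitely many rows have mean above 1, and each of them has a finite sum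
because its conditional mean is finite.\<close>

lemma exceptional_rows_finite:
  assumes "\<And>i. AE \<omega> in P. row_mean i (X i \<omega>) < \<infinity>"
    and "(\<Sum>i. emeasure P {\<omega> \<in> space P. 1 < row_mean i (X i \<omega>)}) < \<infinity>"
  shows "AE z in P \<Otimes>\<^sub>M Q. (\<Sum>i. \<Sum>j. ennreal (entry i j (fst z) (snd z))
    * indicator {x. 1 < row_mean i x} (X i (fst z))) < \<infinity>"
proof -
  have "AE z in P \<Otimes>\<^sub>M Q. \<forall>i. (\<Sum>j. ennreal (entry i j (fst z) (snd z))) < \<infinity>"
    using AE_row_sum_finite[OF assms(1)] by (subst AE_all_countable) blast
  moreover have "AE z in P \<Otimes>\<^sub>M Q. \<forall>\<^sub>F i in sequentially. row_mean i (X i (fst z)) \<le> 1"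
    using AE_eventually_row_mean_le_1[OF assms(2)] by (intro PQ.AE_pair_measure) auto
  ultimately show ?thesis
  proof eventually_elim
    case (elim z)
    show ?case
    proof (rule suminf_ennreal_finite_eventually_eq[where v="\<lambda>_. 0"])
      show "\<forall>\<^sub>F i in sequentially. (\<Sum>j. ennreal (entry i j (fst z) (snd z))
          * indicator {x. 1 < row_mean i x} (X i (fst z))) = 0"
        using elim(2) by eventually_elim simp
      show "(\<Sum>j. ennreal (entry i j (fst z) (snd z))
          * indicator {x. 1 < row_mean i x} (X i (fst z))) < \<infinity>" for i
        using elim(1) by (auto simp: indicator_def)
    qed simp
  qed
qed

text \<open>Truncating can only decrease the row and column means, and the truncation vanishes on the rows and columns whose
mean exceeds 1. So all means of the truncated kernel are at most 1.\<close>

definition truncated :: "nat \<Rightarrow> nat \<Rightarrow> 'e \<times> 'f \<Rightarrow> real" where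
  "truncated i j z = f i j z * indicator {x. row_mean i x \<le> 1} (fst z) * indicator {y. col_mean j y \<le> 1} (snd z)"

lemma truncated_kernel: "two_sample_kernel P Q E F X Y truncated"
proof
  show "truncated i j \<in> borel_measurable (E \<Otimes>\<^sub>M F)" for i j
    unfolding truncated_def by measurable
qed (auto simp: truncated_def X_indep Y_indep f_nonneg f_le_1 indicator_def)

lemma truncated_le: "truncated i j z \<le> f i j z"
  by (simp add: truncated_def indicator_def f_nonneg)

lemma truncated_row_mean_le_1: "two_sample_kernel.row_mean Q Y truncated i x \<le> 1"
proof -
  interpret T: two_sample_kernel P Q E F X Y truncated by (rule truncated_kernel)
  show ?thesis
  proof (cases "row_mean i x \<le> 1")
    case True
    have "T.row_mean i x \<le> row_mean i x"
      unfolding T.row_mean_def row_mean_def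
      by (intro suminf_le nn_integral_mono ennreal_leI truncated_le) auto
    then show ?thesis using True by simp
  next
    case False
    then show ?thesis by (simp add: T.row_mean_def truncated_def)
  qed
qed

lemma truncated_col_mean_le_1: "two_sample_kernel.col_mean P X truncated j y \<le> 1"
proof -
  interpret S: two_sample_kernel Q P F E Y X "\<lambda>j i z. f i j (snd z, fst z)" by (rule swap)
  interpret T: two_sample_kernel P Q E F X Y truncated by (rule truncated_kernel)
  have [simp]: "S.row_mean = col_mean" "S.col_mean = row_mean"
    by (auto simp: fun_eq_iff S.row_mean_def S.col_mean_def row_mean_def col_mean_def)
  interpret TS: two_sample_kernel Q P F E Y X S.truncated by (rule S.truncated_kernel)
  have "T.col_mean j y = TS.row_mean j y"
    unfolding T.col_mean_def TS.row_mean_def by (simp add: truncated_def S.truncated_def mult_ac)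
  also have "\<dots> \<le> 1" by (rule S.truncated_row_mean_le_1)
  finally show ?thesis .
qed

text \<open>For the converse each entry is at most the sum of its truncation and its restrictions to exceptional rows
and to exceptional columns, and each of the three double sums is almost surely finite.\<close>

theorem total_finite_iff:
  "(AE z in P \<Otimes>\<^sub>M Q. total (fst z) (snd z) < \<infinity>) \<longleftrightarrow>
    ((\<forall>i. AE \<omega> in P. row_mean i (X i \<omega>) < \<infinity>) \<and> (\<forall>j. AE \<omega>' in Q. col_mean j (Y j \<omega>') < \<infinity>)) \<and>
    ((\<Sum>i. emeasure P {\<omega> \<in> space P. 1 < row_mean i (X i \<omega>)}) < \<infinity> \<and>
     (\<Sum>j. emeasure Q {\<omega>' \<in> space Q. 1 < col_mean j (Y j \<omega>')}) < \<infinity>) \<and>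
    (\<Sum>i. \<Sum>j. \<integral>\<^sup>+z. ennreal (truncated i j (X i (fst z), Y j (snd z))) \<partial>(P \<Otimes>\<^sub>M Q)) < \<infinity>"
  (is "?B \<longleftrightarrow> ?C1 \<and> ?C2 \<and> ?C3")
proof -
  interpret S: two_sample_kernel Q P F E Y X "\<lambda>j i z. f i j (snd z, fst z)" by (rule swap)
  interpret T: two_sample_kernel P Q E F X Y truncated by (rule truncated_kernel)
  have S_mean: "S.row_mean = col_mean"
    by (auto simp: fun_eq_iff S.row_mean_def col_mean_def)
  have S_total: "S.total \<omega>' \<omega> = total \<omega> \<omega>'" for \<omega> \<omega>'
    unfolding S.total_def total_def fst_conv snd_conv by (rule suminf_ennreal_swap)
  show ?thesis
  proof (intro iffI conjI; (elim conjE)?)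
    assume B: ?B
    note P_first = B[unfolded AE_total_iff_iterated(1)]
    note Q_first = B[unfolded AE_total_iff_iterated(2), folded S_total]
    show "\<forall>i. AE \<omega> in P. row_mean i (X i \<omega>) < \<infinity>"
      using row_conditions_if_total_finite(1)[OF P_first] by blast
    show "\<forall>j. AE \<omega>' in Q. col_mean j (Y j \<omega>') < \<infinity>"
      using S.row_conditions_if_total_finite(1)[OF Q_first] unfolding S_mean by blast
    show "(\<Sum>i. emeasure P {\<omega> \<in> space P. 1 < row_mean i (X i \<omega>)}) < \<infinity>"
      by (rule row_conditions_if_total_finite(2)[OF P_first])
    show "(\<Sum>j. emeasure Q {\<omega>' \<in> space Q. 1 < col_mean j (Y j \<omega>')}) < \<infinity>"
      using S.row_conditions_if_total_finite(2)[OF Q_first] unfolding S_mean .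
    have "AE z in P \<Otimes>\<^sub>M Q. T.total (fst z) (snd z) < \<infinity>"
      using B
    proof eventually_elim
      case (elim z)
      have "T.total (fst z) (snd z) \<le> total (fst z) (snd z)"
        unfolding T.total_def total_def by (intro suminf_le ennreal_leI truncated_le) auto
      then show ?case using elim by (rule order_le_less_trans)
    qed
    then show ?C3
      using T.mean_finite_if_total_finite truncated_row_mean_le_1 truncated_col_mean_le_1
      by (simp add: T.entry_def)
  next
    assume C1: "\<forall>i. AE \<omega> in P. row_mean i (X i \<omega>) < \<infinity>" "\<forall>j. AE \<omega>' in Q. col_mean j (Y j \<omega>') < \<infinity>"
      and C2: "(\<Sum>i. emeasure P {\<omega> \<in> space P. 1 < row_mean i (X i \<omega>)}) < \<infinity>"
        "(\<Sum>j. emeasure Q {\<omega>' \<in> space Q. 1 < col_mean j (Y j \<omega>')}) < \<infinity>"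
      and C3: ?C3
    define t where "t i j z = ennreal (truncated i j (X i (fst z), Y j (snd z)))" for i j z
    define r where "r i j z = ennreal (entry i j (fst z) (snd z)) * indicator {x. 1 < row_mean i x} (X i (fst z))" for i j z
    define c where "c i j z = ennreal (entry i j (fst z) (snd z)) * indicator {y. 1 < col_mean j y} (Y j (snd z))" for i j z
    have tm[measurable]: "t i j \<in> borel_measurable (P \<Otimes>\<^sub>M Q)" for i j unfolding t_def by measurable
    have cm[measurable]: "c i j \<in> borel_measurable (P \<Otimes>\<^sub>M Q)" for i j
      unfolding c_def entry_def by measurable
    have "(\<integral>\<^sup>+z. (\<Sum>i. \<Sum>j. t i j z) \<partial>(P \<Otimes>\<^sub>M Q)) = (\<Sum>i. \<Sum>j. \<integral>\<^sup>+z. t i j z \<partial>(P \<Otimes>\<^sub>M Q))"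
      by (simp add: nn_integral_suminf)
    then have "AE z in P \<Otimes>\<^sub>M Q. (\<Sum>i. \<Sum>j. t i j z) \<noteq> \<infinity>"
      using C3 by (intro nn_integral_noteq_infinite) (auto simp: t_def)
    moreover have "AE z in P \<Otimes>\<^sub>M Q. (\<Sum>i. \<Sum>j. r i j z) < \<infinity>"
      unfolding r_def using C1(1) C2(1) by (intro exceptional_rows_finite) auto
    moreover have "AE z in P \<Otimes>\<^sub>M Q. (\<Sum>j. \<Sum>i. c i j z) < \<infinity>"
    proof (rule PQ.AE_pair_measure)
      have "AE z in Q \<Otimes>\<^sub>M P. (\<Sum>j. \<Sum>i. c i j (snd z, fst z)) < \<infinity>"
        using S.exceptional_rows_finite C1(2) C2(2) unfolding S_mean
        by (simp add: c_def S.entry_def entry_def)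
      then have "AE \<omega>' in Q. AE \<omega> in P. (\<Sum>j. \<Sum>i. c i j (\<omega>, \<omega>')) < \<infinity>"
        by (auto dest: S.PQ.AE_pair)
      then show "AE \<omega> in P. AE \<omega>' in Q. (\<Sum>j. \<Sum>i. c i j (\<omega>, \<omega>')) < \<infinity>"
        by (subst PQ.AE_commute) auto
    qed measurable
    ultimately show ?B
    proof eventually_elim
      case (elim z)
      have le: "ennreal (entry i j (fst z) (snd z)) \<le> t i j z + r i j z + c i j z" for i j
        by (auto simp: t_def r_def c_def truncated_def entry_def indicator_def not_le)
      have "total (fst z) (snd z) \<le> (\<Sum>i. \<Sum>j. t i j z + r i j z + c i j z)"
        unfolding total_def using le[unfolded entry_def] by (intro suminf_le) auto
      also have "\<dots> = (\<Sum>i. \<Sum>j. t i j z) + (\<Sum>i. \<Sum>j. r i j z) + (\<Sum>i. \<Sum>j. c i j z)"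
        by (simp add: suminf_add[symmetric])
      also have "(\<Sum>i. \<Sum>j. c i j z) = (\<Sum>j. \<Sum>i. c i j z)" by (rule suminf_ennreal_swap)
      also have "(\<Sum>i. \<Sum>j. t i j z) + (\<Sum>i. \<Sum>j. r i j z) + (\<Sum>j. \<Sum>i. c i j z) < \<infinity>"
        using elim by (simp add: ennreal_add_less_top top.not_eq_extremum)
      finally show ?case .
    qed
  qed
qed

end

section \<open>Rademacher series\<close>

text \<open>The partial sums \<open>\<Sum>i<n. b i * e i\<close>, frozen from the first time their absolute value reaches \<open>t\<close>. Having crossed
\<open>t\<close> at some time up to \<open>n\<close> is thereby visible in the single value at time \<open>n\<close>.\<close>

primrec stopped_sum :: "real \<Rightarrow> (nat \<Rightarrow> real) \<Rightarrow> (nat \<Rightarrow> real) \<Rightarrow> nat \<Rightarrow> real" where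
  "stopped_sum t b e 0 = 0"
| "stopped_sum t b e (Suc n) = stopped_sum t b e n + (if \<bar>stopped_sum t b e n\<bar> < t then b n * e n else 0)"

lemma stopped_sum_cong:
  assumes "\<And>i. i < n \<Longrightarrow> e i = e' i"
  shows "stopped_sum t b e n = stopped_sum t b e' n"
  using assms by (induction n) auto

lemma stopped_sum_measurable:
  "n \<le> m \<Longrightarrow> (\<lambda>e. stopped_sum t b e n) \<in> borel_measurable (PiM {..<m} (\<lambda>_. borel))"
proof (induction n)
  case (Suc n)
  then have [measurable]: "(\<lambda>e. stopped_sum t b e n) \<in> borel_measurable (PiM {..<m} (\<lambda>_. borel))"
    by simp
  have [measurable]: "(\<lambda>e. e n) \<in> borel_measurable (PiM {..<m} (\<lambda>_. borel :: real measure))"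
    using Suc.prems by (intro measurable_component_singleton) simp
  show ?case by simp
qed simp

lemma stopped_sum_frozen:
  assumes "n \<le> m" "t \<le> \<bar>stopped_sum t b e n\<bar>"
  shows "t \<le> \<bar>stopped_sum t b e m\<bar>"
  using assms by (induction m rule: dec_induct) auto

lemma stopped_sum_eq_sum:
  assumes "\<bar>stopped_sum t b e n\<bar> < t"
  shows "stopped_sum t b e n = (\<Sum>i<n. b i * e i)"
  using assms
proof (induction n)
  case (Suc n)
  have "\<bar>stopped_sum t b e n\<bar> < t"
    using stopped_sum_frozen[of n "Suc n" t b e] Suc.prems
    by (meson le_SucI le_refl not_le)
  then show ?case using Suc by simp
qed simp

text \<open>The signs are \<open>\<plusminus>1\<close> at every point rather than almost everywhere, so that squares of signs cancel by rewriting. A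
Rademacher sequence in the usual sense agrees almost surely with one of this form.\<close>

locale rademacher_sequence = prob_space M for M :: "'a measure" +
  fixes eps :: "nat \<Rightarrow> 'a \<Rightarrow> real"
  assumes eps_indep: "indep_vars (\<lambda>_. borel) eps UNIV"
    and eps_values: "\<And>i \<omega>. eps i \<omega> = 1 \<or> eps i \<omega> = - 1"
    and eps_mean: "\<And>i. expectation (eps i) = 0"
begin

lemma eps_measurable [measurable]: "eps i \<in> borel_measurable M"
  using eps_indep by (auto simp: indep_vars_def)

lemma eps_square [simp]: "eps i \<omega> * eps i \<omega> = 1"
  using eps_values[of i \<omega>] by auto

lemma eps_abs [simp]: "\<bar>eps i \<omega>\<bar> = 1"
  using eps_values[of i \<omega>] by auto

text \<open>Everything built from finitely many signs is bounded, hence integrable; the closure rules below discharge the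
integrability conditions.\<close>

definition bounded_rv :: "('a \<Rightarrow> real) \<Rightarrow> bool" where
  "bounded_rv g \<longleftrightarrow> g \<in> borel_measurable M \<and> (\<exists>B. \<forall>\<omega>. \<bar>g \<omega>\<bar> \<le> B)"

lemma bounded_rv_const: "bounded_rv (\<lambda>_. c)"
  by (auto simp: bounded_rv_def)

lemma bounded_rv_eps: "bounded_rv (eps i)"
  by (auto simp: bounded_rv_def intro: exI[of _ 1])

lemma bounded_rv_add:
  assumes "bounded_rv f" "bounded_rv g" shows "bounded_rv (\<lambda>\<omega>. f \<omega> + g \<omega>)"
proof -
  from assms obtain A B where "\<And>\<omega>. \<bar>f \<omega>\<bar> \<le> A" "\<And>\<omega>. \<bar>g \<omega>\<bar> \<le> B" by (auto simp: bounded_rv_def)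
  then have "\<bar>f \<omega> + g \<omega>\<bar> \<le> A + B" for \<omega>
    by (intro order_trans[OF abs_triangle_ineq] add_mono)
  then show ?thesis using assms by (auto simp: bounded_rv_def)
qed

lemma bounded_rv_mult:
  assumes "bounded_rv f" "bounded_rv g" shows "bounded_rv (\<lambda>\<omega>. f \<omega> * g \<omega>)"
proof -
  from assms obtain A B where "\<And>\<omega>. \<bar>f \<omega>\<bar> \<le> A" "\<And>\<omega>. \<bar>g \<omega>\<bar> \<le> B" by (auto simp: bounded_rv_def)
  then have "\<bar>f \<omega> * g \<omega>\<bar> \<le> A * B" for \<omega>
    unfolding abs_mult by (intro mult_mono') auto
  then show ?thesis using assms by (auto simp: bounded_rv_def)
qed

lemma bounded_rv_power: "bounded_rv f \<Longrightarrow> bounded_rv (\<lambda>\<omega>. (f \<omega>) ^ n)"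
  by (induction n) (auto intro: bounded_rv_const bounded_rv_mult)

lemma bounded_rv_sum: "(\<And>i. i \<in> I \<Longrightarrow> bounded_rv (f i)) \<Longrightarrow> bounded_rv (\<lambda>\<omega>. \<Sum>i\<in>I. f i \<omega>)"
  by (induction I rule: infinite_finite_induct) (auto intro: bounded_rv_const bounded_rv_add)

lemma bounded_rv_if:
  assumes "bounded_rv f" "Measurable.pred M S"
  shows "bounded_rv (\<lambda>\<omega>. if S \<omega> then f \<omega> else 0)"
proof -
  from assms obtain A where "\<And>\<omega>. \<bar>f \<omega>\<bar> \<le> A" by (auto simp: bounded_rv_def)
  then have "\<bar>if S \<omega> then f \<omega> else 0\<bar> \<le> \<bar>A\<bar>" for \<omega>
    using order_trans[OF _ abs_ge_self] by auto
  moreover have "(\<lambda>\<omega>. if S \<omega> then f \<omega> else 0) \<in> borel_measurable M"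
    using assms by (auto simp: bounded_rv_def)
  ultimately show ?thesis unfolding bounded_rv_def by blast
qed

lemmas bounded_rv_intros = bounded_rv_const bounded_rv_eps bounded_rv_add bounded_rv_mult
  bounded_rv_power bounded_rv_sum

lemma bounded_rv_integrable: "bounded_rv f \<Longrightarrow> integrable M f"
  by (auto simp: bounded_rv_def intro!: integrable_const_bound AE_I2)

text \<open>The sign \<open>eps k\<close> is centred and independent of the earlier ones. The past enters as a function \<open>G\<close> of the whole
sequence that depends only on the coordinates below \<open>k\<close>.\<close>

lemma expectation_eps_times_past:
  assumes meas: "G \<in> borel_measurable (PiM {..<k} (\<lambda>_. borel))"
    and past: "\<And>e. G (restrict e {..<k}) = G e"
    and int: "integrable M (\<lambda>\<omega>. G (\<lambda>i. eps i \<omega>))"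
  shows "expectation (\<lambda>\<omega>. eps k \<omega> * G (\<lambda>i. eps i \<omega>)) = 0"
proof -
  have "indep_var borel ((\<lambda>e. e k) \<circ> (\<lambda>\<omega>. restrict (\<lambda>i. eps i \<omega>) {k}))
      borel (G \<circ> (\<lambda>\<omega>. restrict (\<lambda>i. eps i \<omega>) {..<k}))"
    using meas by (intro indep_var_compose[OF indep_var_restrict[OF eps_indep]]) auto
  then have "indep_var borel (eps k) borel (\<lambda>\<omega>. G (\<lambda>i. eps i \<omega>))"
    by (simp add: comp_def past)
  then show ?thesis
    using int by (subst indep_var_lebesgue_integral)
      (auto intro: bounded_rv_integrable bounded_rv_eps simp: eps_mean)
qed

definition signed_sum :: "(nat \<Rightarrow> real) \<Rightarrow> nat \<Rightarrow> 'a \<Rightarrow> real" where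
  "signed_sum p n \<omega> = (\<Sum>i<n. p i * eps i \<omega>)"

lemma signed_sum_0 [simp]: "signed_sum p 0 \<omega> = 0" and signed_sum_Suc: "signed_sum p (Suc n) \<omega> = signed_sum p n \<omega> + p n * eps n \<omega>"
  by (simp_all add: signed_sum_def)

lemma signed_sum_measurable [measurable]: "signed_sum p n \<in> borel_measurable M"
  unfolding signed_sum_def[abs_def] by measurable

lemma bounded_rv_signed_sum: "bounded_rv (signed_sum p n)"
  unfolding signed_sum_def[abs_def] by (intro bounded_rv_intros)

lemma signed_sum_second_moment: "expectation (\<lambda>\<omega>. (signed_sum p n \<omega>)\<^sup>2) = (\<Sum>i<n. (p i)\<^sup>2)"
proof (induction n)
  case (Suc n)
  have orth: "expectation (\<lambda>\<omega>. eps n \<omega> * signed_sum p n \<omega>) = 0"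
    unfolding signed_sum_def
    by (rule expectation_eps_times_past[where G="\<lambda>e. \<Sum>i<n. p i * e i"])
      (auto intro!: bounded_rv_integrable bounded_rv_intros)
  have "(signed_sum p (Suc n) \<omega>)\<^sup>2 = (signed_sum p n \<omega>)\<^sup>2 + 2 * p n * (eps n \<omega> * signed_sum p n \<omega>) + (p n)\<^sup>2 * (eps n \<omega> * eps n \<omega>)" for \<omega>
    unfolding signed_sum_Suc by (simp only: power2_eq_square algebra_simps)
  then have "expectation (\<lambda>\<omega>. (signed_sum p (Suc n) \<omega>)\<^sup>2)
      = expectation (\<lambda>\<omega>. (signed_sum p n \<omega>)\<^sup>2 + 2 * p n * (eps n \<omega> * signed_sum p n \<omega>) + (p n)\<^sup>2)"
    by simp
  also have "\<dots> = expectation (\<lambda>\<omega>. (signed_sum p n \<omega>)\<^sup>2) + 2 * p n * expectation (\<lambda>\<omega>. eps n \<omega> * signed_sum p n \<omega>) + (p n)\<^sup>2"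
    by (subst Bochner_Integration.integral_add Bochner_Integration.integral_mult_right_zero
        | intro bounded_rv_integrable bounded_rv_intros bounded_rv_signed_sum | simp add: prob_space)+
  finally show ?case using Suc by (simp add: orth)
qed simp

text \<open>By induction: when a sign is added, the terms with an odd power of it vanish, and the mixed term
\<open>4 p q P Q\<close> is absorbed by \<open>2 (p\<^sup>2 Q\<^sup>2 + q\<^sup>2 P\<^sup>2)\<close>. For \<open>p = q\<close> this is Khintchine's inequality for the fourth
moment; the mixed form gives second moments of sums of squares of Rademacher sums.\<close>

lemma signed_sum_mixed_fourth_moment:
  "expectation (\<lambda>\<omega>. (signed_sum p n \<omega>)\<^sup>2 * (signed_sum q n \<omega>)\<^sup>2) \<le> 3 * (\<Sum>i<n. (p i)\<^sup>2) * (\<Sum>i<n. (q i)\<^sup>2)"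
proof (induction n)
  case (Suc n)
  define G where "G a b = 2 * p n * a * (b\<^sup>2 + (q n)\<^sup>2) + 2 * q n * b * (a\<^sup>2 + (p n)\<^sup>2)" for a b
  define R where "R \<omega> = eps n \<omega> * G (signed_sum p n \<omega>) (signed_sum q n \<omega>)" for \<omega>
  \<comment> \<open>\<open>R\<close> collects the odd terms, and \<open>D\<close> bounds the even ones\<close>
  define D where "D \<omega> = (signed_sum p n \<omega>)\<^sup>2 * (signed_sum q n \<omega>)\<^sup>2 + 3 * (q n)\<^sup>2 * (signed_sum p n \<omega>)\<^sup>2
      + 3 * (p n)\<^sup>2 * (signed_sum q n \<omega>)\<^sup>2 + (p n)\<^sup>2 * (q n)\<^sup>2" for \<omega>
  have orth: "expectation R = 0"
    unfolding R_def signed_sum_def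
    by (rule expectation_eps_times_past[where G="\<lambda>e. G (\<Sum>i<n. p i * e i) (\<Sum>i<n. q i * e i)"])
      (auto simp: G_def intro!: bounded_rv_integrable bounded_rv_intros)
  have R: "integrable M R" and D: "integrable M D"
    unfolding R_def D_def G_def by (intro bounded_rv_integrable bounded_rv_intros bounded_rv_signed_sum)+
  have pt: "(signed_sum p (Suc n) \<omega>)\<^sup>2 * (signed_sum q (Suc n) \<omega>)\<^sup>2 \<le> D \<omega> + R \<omega>" for \<omega>
  proof -
    let ?P = "signed_sum p n \<omega>" and ?Q = "signed_sum q n \<omega>" and ?e = "eps n \<omega>"
    have sq: "(x + y * ?e)\<^sup>2 = x\<^sup>2 + y\<^sup>2 + 2 * x * y * ?e" for x y
    proof -
      have "(x + y * ?e)\<^sup>2 = x\<^sup>2 + y\<^sup>2 * (?e * ?e) + 2 * x * y * ?e"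
        by (simp only: power2_eq_square algebra_simps)
      then show ?thesis by simp
    qed
    have "(signed_sum p (Suc n) \<omega>)\<^sup>2 * (signed_sum q (Suc n) \<omega>)\<^sup>2
        = (?P\<^sup>2 + (p n)\<^sup>2) * (?Q\<^sup>2 + (q n)\<^sup>2) + 4 * (?P * q n) * (?Q * p n) * (?e * ?e) + R \<omega>"
      unfolding signed_sum_Suc sq R_def G_def by (simp only: algebra_simps)
    also have "\<dots> = (?P\<^sup>2 + (p n)\<^sup>2) * (?Q\<^sup>2 + (q n)\<^sup>2) + 4 * (?P * q n) * (?Q * p n) + R \<omega>"
      by simp
    also have "4 * (?P * q n) * (?Q * p n) \<le> 2 * ((?P * q n)\<^sup>2 + (?Q * p n)\<^sup>2)"
      using sum_squares_bound[of "?P * q n" "?Q * p n"] by simp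
    finally show ?thesis by (simp add: D_def algebra_simps power_mult_distrib)
  qed
  have "expectation (\<lambda>\<omega>. (signed_sum p (Suc n) \<omega>)\<^sup>2 * (signed_sum q (Suc n) \<omega>)\<^sup>2) \<le> expectation (\<lambda>\<omega>. D \<omega> + R \<omega>)"
    using R D pt
    by (intro integral_mono Bochner_Integration.integrable_add)
      (auto intro!: bounded_rv_integrable bounded_rv_intros bounded_rv_signed_sum)
  also have "\<dots> = expectation D" using R D orth by simp
  also have "\<dots> = expectation (\<lambda>\<omega>. (signed_sum p n \<omega>)\<^sup>2 * (signed_sum q n \<omega>)\<^sup>2)
      + 3 * (q n)\<^sup>2 * expectation (\<lambda>\<omega>. (signed_sum p n \<omega>)\<^sup>2)
      + 3 * (p n)\<^sup>2 * expectation (\<lambda>\<omega>. (signed_sum q n \<omega>)\<^sup>2) + (p n)\<^sup>2 * (q n)\<^sup>2"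
    unfolding D_def
    by (subst Bochner_Integration.integral_add Bochner_Integration.integral_mult_right_zero
        | intro bounded_rv_integrable bounded_rv_intros bounded_rv_signed_sum | simp add: prob_space)+
  also have "\<dots> \<le> 3 * (\<Sum>i<n. (p i)\<^sup>2) * (\<Sum>i<n. (q i)\<^sup>2) + 3 * (q n)\<^sup>2 * (\<Sum>i<n. (p i)\<^sup>2)
      + 3 * (p n)\<^sup>2 * (\<Sum>i<n. (q i)\<^sup>2) + 3 * (p n)\<^sup>2 * (q n)\<^sup>2"
    using Suc by (auto simp: signed_sum_second_moment intro!: add_increasing)
  also have "\<dots> = 3 * (\<Sum>i<Suc n. (p i)\<^sup>2) * (\<Sum>i<Suc n. (q i)\<^sup>2)"
    by (simp add: algebra_simps)
  finally show ?case .
qed simp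

lemma bounded_rv_stopped_sum: "bounded_rv (\<lambda>\<omega>. stopped_sum t b (\<lambda>i. eps i \<omega>) n)"
proof (induction n)
  case (Suc n)
  have [measurable]: "(\<lambda>\<omega>. stopped_sum t b (\<lambda>i. eps i \<omega>) n) \<in> borel_measurable M"
    using Suc by (simp add: bounded_rv_def)
  show ?case
    unfolding stopped_sum.simps
    by (intro bounded_rv_add Suc bounded_rv_if bounded_rv_intros) measurable
qed (simp add: bounded_rv_const)

text \<open>Whether the sum is already frozen is decided by the past, so the increments of the stopped sum are still
orthogonal to it.\<close>

lemma stopped_sum_second_moment:
  "expectation (\<lambda>\<omega>. (stopped_sum t b (\<lambda>i. eps i \<omega>) n)\<^sup>2) \<le> (\<Sum>i<n. (b i)\<^sup>2)"
proof (induction n)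
  case (Suc n)
  define T where "T e = stopped_sum t b e n" for e
  define G where "G e = (if \<bar>T e\<bar> < t then b n * T e else 0)" for e
  have bT: "bounded_rv (\<lambda>\<omega>. T (\<lambda>i. eps i \<omega>))" unfolding T_def by (rule bounded_rv_stopped_sum)
  then have [measurable]: "(\<lambda>\<omega>. T (\<lambda>i. eps i \<omega>)) \<in> borel_measurable M" by (simp add: bounded_rv_def)
  have bG: "bounded_rv (\<lambda>\<omega>. G (\<lambda>i. eps i \<omega>))" unfolding G_def
    by (intro bounded_rv_if bounded_rv_intros bT) measurable
  have Tm[measurable]: "T \<in> borel_measurable (PiM {..<n} (\<lambda>_. borel))"
    unfolding T_def by (rule stopped_sum_measurable) simp
  have Tr: "T (restrict e {..<n}) = T e" for e
    unfolding T_def by (rule stopped_sum_cong) simp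
  have orth: "expectation (\<lambda>\<omega>. eps n \<omega> * G (\<lambda>i. eps i \<omega>)) = 0"
  proof (rule expectation_eps_times_past)
    show "G \<in> borel_measurable (PiM {..<n} (\<lambda>_. borel))" unfolding G_def[abs_def] by measurable
    show "G (restrict e {..<n}) = G e" for e unfolding G_def Tr ..
  qed (rule bounded_rv_integrable[OF bG])
  have "expectation (\<lambda>\<omega>. (stopped_sum t b (\<lambda>i. eps i \<omega>) (Suc n))\<^sup>2)
      \<le> expectation (\<lambda>\<omega>. (T (\<lambda>i. eps i \<omega>))\<^sup>2 + 2 * (eps n \<omega> * G (\<lambda>i. eps i \<omega>)) + (b n)\<^sup>2)"
  proof (rule integral_mono)
    show "integrable M (\<lambda>\<omega>. (stopped_sum t b (\<lambda>i. eps i \<omega>) (Suc n))\<^sup>2)"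
      by (intro bounded_rv_integrable bounded_rv_intros bounded_rv_stopped_sum)
    show "integrable M (\<lambda>\<omega>. (T (\<lambda>i. eps i \<omega>))\<^sup>2 + 2 * (eps n \<omega> * G (\<lambda>i. eps i \<omega>)) + (b n)\<^sup>2)"
      by (intro bounded_rv_integrable bounded_rv_intros bT bG)
    show "(stopped_sum t b (\<lambda>i. eps i \<omega>) (Suc n))\<^sup>2
        \<le> (T (\<lambda>i. eps i \<omega>))\<^sup>2 + 2 * (eps n \<omega> * G (\<lambda>i. eps i \<omega>)) + (b n)\<^sup>2" for \<omega>
    proof -
      have "(T (\<lambda>i. eps i \<omega>) + b n * eps n \<omega>)\<^sup>2 = (T (\<lambda>i. eps i \<omega>))\<^sup>2
          + 2 * (eps n \<omega> * (b n * T (\<lambda>i. eps i \<omega>))) + (b n)\<^sup>2 * (eps n \<omega> * eps n \<omega>)"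
        by (simp only: power2_eq_square algebra_simps)
      then show ?thesis by (simp add: T_def G_def)
    qed
  qed
  also have "\<dots> = expectation (\<lambda>\<omega>. (T (\<lambda>i. eps i \<omega>))\<^sup>2)
      + 2 * expectation (\<lambda>\<omega>. eps n \<omega> * G (\<lambda>i. eps i \<omega>)) + (b n)\<^sup>2"
    by (subst Bochner_Integration.integral_add Bochner_Integration.integral_mult_right_zero
        | intro bounded_rv_integrable bounded_rv_intros bT bG | simp add: prob_space)+
  finally show ?case using Suc by (simp add: orth T_def)
qed simp

text \<open>Once the partial sums reach \<open>t\<close>, the stopped sum stays at or above \<open>t\<close> in absolute value. The events that it has
done so by time \<open>n\<close> are therefore increasing, and Chebyshev's inequality bounds each of them.\<close>

lemma kolmogorov_maximal_inequality:
  assumes t: "0 < t" and V: "\<And>n. (\<Sum>i<n. (b i)\<^sup>2) \<le> V"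
  shows "prob {\<omega> \<in> space M. \<exists>n. t \<le> \<bar>signed_sum b n \<omega>\<bar>} \<le> V / t\<^sup>2"
proof -
  define T where "T n \<omega> = stopped_sum t b (\<lambda>i. eps i \<omega>) n" for n \<omega>
  define A where "A n = {\<omega> \<in> space M. t \<le> \<bar>T n \<omega>\<bar>}" for n
  have bT: "bounded_rv (T n)" for n unfolding T_def by (rule bounded_rv_stopped_sum)
  then have [measurable]: "T n \<in> borel_measurable M" for n by (simp add: bounded_rv_def)
  have [measurable]: "A n \<in> events" for n unfolding A_def by measurable
  have le: "prob (A n) \<le> V / t\<^sup>2" for n
  proof -
    have "prob (A n) = expectation (indicat_real (A n))" by simp
    also have "\<dots> \<le> expectation (\<lambda>\<omega>. (T n \<omega>)\<^sup>2 / t\<^sup>2)"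
    proof (rule integral_mono)
      show "integrable M (indicat_real (A n))"
        by (intro integrable_const_bound[where B=1]) (auto simp: indicator_def)
      show "integrable M (\<lambda>\<omega>. (T n \<omega>)\<^sup>2 / t\<^sup>2)"
        unfolding divide_inverse by (intro bounded_rv_integrable bounded_rv_intros bT)
      show "indicat_real (A n) \<omega> \<le> (T n \<omega>)\<^sup>2 / t\<^sup>2" for \<omega>
        using t power_mono[of t "\<bar>T n \<omega>\<bar>" 2] by (auto simp: indicator_def A_def)
    qed
    also have "\<dots> = expectation (\<lambda>\<omega>. (T n \<omega>)\<^sup>2) / t\<^sup>2" by simp
    also have "\<dots> \<le> V / t\<^sup>2"
      using stopped_sum_second_moment[of t b n] V[of n] by (intro divide_right_mono) (auto simp: T_def)
    finally show ?thesis .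
  qed
  have inc: "incseq A"
    unfolding incseq_def A_def T_def using stopped_sum_frozen by blast
  have "(\<lambda>n. prob (A n)) \<longlonglongrightarrow> prob (\<Union>n. A n)"
    by (rule finite_Lim_measure_incseq[OF _ inc]) auto
  then have "prob (\<Union>n. A n) \<le> V / t\<^sup>2"
    using le by (intro LIMSEQ_le_const2) auto
  moreover have "{\<omega> \<in> space M. \<exists>n. t \<le> \<bar>signed_sum b n \<omega>\<bar>} \<subseteq> (\<Union>n. A n)"
  proof clarify
    fix \<omega> n assume \<omega>: "\<omega> \<in> space M" and n: "t \<le> \<bar>signed_sum b n \<omega>\<bar>"
    have "t \<le> \<bar>T n \<omega>\<bar>"
    proof (rule ccontr)
      assume "\<not> ?thesis"
      then have "\<bar>T n \<omega>\<bar> < t" by simp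
      moreover from this have "T n \<omega> = signed_sum b n \<omega>"
        unfolding T_def signed_sum_def by (rule stopped_sum_eq_sum)
      ultimately show False using n by simp
    qed
    then show "\<omega> \<in> (\<Union>n. A n)" using \<omega> by (auto simp: A_def)
  qed
  then have "prob {\<omega> \<in> space M. \<exists>n. t \<le> \<bar>signed_sum b n \<omega>\<bar>} \<le> prob (\<Union>n. A n)"
    by (intro finite_measure_mono) auto
  ultimately show ?thesis by simp
qed

text \<open>The maximal inequality for the tail of the series beyond \<open>m\<close> bounds the probability that some later partial sum
differs from the \<open>m\<close>-th one by \<open>t\<close>. The bound tends to 0 with \<open>m\<close>, so the partial sums are almost surely Cauchy.\<close>

lemma rademacher_series_convergent:
  assumes sb: "summable (\<lambda>i. (b i)\<^sup>2)"
  shows "AE \<omega> in M. convergent (\<lambda>n. signed_sum b n \<omega>)"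
proof -
  \<comment> \<open>replacing the first \<open>m\<close> coefficients by 0 gives the tail without shifting the signs\<close>
  define c where "c m i = (if i < m then 0 else b i)" for m i :: nat
  define r where "r m = (\<Sum>i. (b (i + m))\<^sup>2)" for m
  have r0: "r \<longlonglongrightarrow> 0" unfolding r_def by (rule suminf_exist_split2[OF sb])
  have tail: "(\<Sum>i<n. (c m i)\<^sup>2) \<le> r m" for m n
  proof -
    have "(\<Sum>i<n. (c m i)\<^sup>2) \<le> (\<Sum>i<n + m. (c m i)\<^sup>2)" by (intro sum_mono2) auto
    also have "\<dots> = (\<Sum>i<n. (b (i + m))\<^sup>2)"
    proof -
      have "(\<Sum>i<n + m. (c m i)\<^sup>2) = (\<Sum>i<m. (c m i)\<^sup>2) + (\<Sum>i<n. (c m (i + m))\<^sup>2)"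
        by (induction n) (auto simp: add.assoc)
      then show ?thesis by (simp add: c_def)
    qed
    also have "\<dots> \<le> r m" unfolding r_def
      using summable_ignore_initial_segment[OF sb, of m] by (intro sum_le_suminf) auto
    finally show ?thesis .
  qed
  have diff: "signed_sum (c m) n \<omega> = signed_sum b n \<omega> - signed_sum b m \<omega>" if "m \<le> n" for m n \<omega>
    using that
  proof (induction n rule: dec_induct)
    case base
    show ?case by (simp add: signed_sum_def c_def)
  qed (simp add: signed_sum_Suc c_def)
  have "AE \<omega> in M. \<exists>m. \<forall>n. \<bar>signed_sum (c m) n \<omega>\<bar> < inverse (real (Suc k))" for k
  proof -
    define t where "t = inverse (real (Suc k))"
    have t: "0 < t" by (simp add: t_def)
    define N where "N = {\<omega> \<in> space M. \<forall>m. \<exists>n. t \<le> \<bar>signed_sum (c m) n \<omega>\<bar>}"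
    have [measurable]: "N \<in> events" unfolding N_def by measurable
    have "prob N \<le> r m / t\<^sup>2" for m
    proof -
      have "prob N \<le> prob {\<omega> \<in> space M. \<exists>n. t \<le> \<bar>signed_sum (c m) n \<omega>\<bar>}"
        by (intro finite_measure_mono) (auto simp: N_def)
      also have "\<dots> \<le> r m / t\<^sup>2" by (rule kolmogorov_maximal_inequality[OF t tail])
      finally show ?thesis .
    qed
    moreover have "(\<lambda>m. r m / t\<^sup>2) \<longlonglongrightarrow> 0 / t\<^sup>2" by (intro tendsto_divide r0) (use t in auto)
    ultimately have "prob N \<le> 0" by (intro LIMSEQ_le_const[of "\<lambda>m. r m / t\<^sup>2"]) auto
    then have "prob N = 0" using measure_nonneg[of M N] by linarith
    then have "AE \<omega> in M. \<omega> \<notin> N" by (subst (asm) prob_eq_0) auto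
    then show ?thesis using AE_space
      by eventually_elim (auto simp: N_def t_def not_le)
  qed
  then have "AE \<omega> in M. \<forall>k. \<exists>m. \<forall>n. \<bar>signed_sum (c m) n \<omega>\<bar> < inverse (real (Suc k))"
    by (subst AE_all_countable) blast
  then show ?thesis
  proof eventually_elim
    case (elim \<omega>)
    have "Cauchy (\<lambda>n. signed_sum b n \<omega>)"
    proof (rule CauchyI)
      fix \<delta> :: real assume "0 < \<delta>"
      then obtain k where k: "inverse (real (Suc k)) < \<delta> / 2" using reals_Archimedean[of "\<delta> / 2"] by auto
      obtain m where m: "\<And>n. \<bar>signed_sum (c m) n \<omega>\<bar> < inverse (real (Suc k))" using elim by blast
      show "\<exists>M. \<forall>i\<ge>M. \<forall>j\<ge>M. norm (signed_sum b i \<omega> - signed_sum b j \<omega>) < \<delta>"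
      proof (intro exI[of _ m] allI impI)
        fix i j assume "m \<le> i" "m \<le> j"
        then show "norm (signed_sum b i \<omega> - signed_sum b j \<omega>) < \<delta>"
          using m[of i] m[of j] k diff[of m i \<omega>] diff[of m j \<omega>] by auto
      qed
    qed
    then show ?case by (simp add: Cauchy_convergent_iff)
  qed
qed

end

section \<open>Rademacher chaos of order two\<close>

lemma convergent_measurable:
  fixes s :: "nat \<Rightarrow> 'x \<Rightarrow> real"
  assumes [measurable]: "\<And>n. s n \<in> borel_measurable N"
  shows "{x \<in> space N. convergent (\<lambda>n. s n x)} \<in> sets N"
  unfolding Cauchy_convergent_iff[symmetric] by measurable

text \<open>Splitting along the diagonal makes the inner sums independent of \<open>n\<close>, so that each part is the partial sum of a
series once the other variable is frozen.\<close>

lemma square_chaos_expand: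
  fixes a :: "nat \<Rightarrow> nat \<Rightarrow> real"
  shows "(\<Sum>i<n. \<Sum>j<n. x i * y j * a i j)
    = (\<Sum>i<n. x i * (\<Sum>j<Suc i. a i j * y j)) + (\<Sum>j<n. y j * (\<Sum>i<j. a i j * x i))"
proof (induction n)
  case (Suc n)
  have "(\<Sum>i<Suc n. \<Sum>j<Suc n. x i * y j * a i j)
      = (\<Sum>i<n. \<Sum>j<n. x i * y j * a i j) + (\<Sum>i<n. x i * y n * a i n) + (\<Sum>j<Suc n. x n * y j * a n j)"
    by (simp add: sum.distrib)
  also have "(\<Sum>i<n. x i * y n * a i n) = y n * (\<Sum>i<n. a i n * x i)"
    by (simp add: sum_distrib_left mult_ac)
  also have "(\<Sum>j<Suc n. x n * y j * a n j) = x n * (\<Sum>j<Suc n. a n j * y j)"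
    unfolding sum_distrib_left by (simp add: mult_ac)
  finally show ?case unfolding Suc by (simp only: sum.lessThan_Suc)
qed simp

locale two_rademacher_sequences = P: rademacher_sequence P e1 + Q: rademacher_sequence Q e2
  for P :: "'p measure" and e1 :: "nat \<Rightarrow> 'p \<Rightarrow> real"
    and Q :: "'q measure" and e2 :: "nat \<Rightarrow> 'q \<Rightarrow> real"
begin

sublocale PQ: pair_prob_space P Q ..

text \<open>The squares of the inner sums have total mean at most the sum of the \<open>(a i j)\<^sup>2\<close>, so for almost every \<open>\<omega>'\<close> the inner sums are
square summable coefficients of a Rademacher series in \<open>e1\<close>.\<close>

lemma row_finite_chaos_convergent:
  fixes a :: "nat \<Rightarrow> nat \<Rightarrow> real" and k :: "nat \<Rightarrow> nat"
  assumes fin: "(\<Sum>i. \<Sum>j. ennreal ((a i j)\<^sup>2)) < \<infinity>"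
  shows "AE z in P \<Otimes>\<^sub>M Q. convergent (\<lambda>n. \<Sum>i<n. e1 i (fst z) * (\<Sum>j<k i. a i j * e2 j (snd z)))"
proof -
  define C where "C \<omega> \<omega>' = convergent (\<lambda>n. \<Sum>i<n. e1 i \<omega> * (\<Sum>j<k i. a i j * e2 j \<omega>'))" for \<omega> \<omega>'
  have meas: "{z \<in> space (P \<Otimes>\<^sub>M Q). C (fst z) (snd z)} \<in> sets (P \<Otimes>\<^sub>M Q)"
    unfolding C_def by (intro convergent_measurable) measurable
  have "(\<integral>\<^sup>+\<omega>'. (\<Sum>i. ennreal ((Q.signed_sum (a i) (k i) \<omega>')\<^sup>2)) \<partial>Q)
      = (\<Sum>i. \<integral>\<^sup>+\<omega>'. ennreal ((Q.signed_sum (a i) (k i) \<omega>')\<^sup>2) \<partial>Q)"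
    by (rule nn_integral_suminf) measurable
  also have "\<dots> = (\<Sum>i. ennreal (\<Sum>j<k i. (a i j)\<^sup>2))"
    unfolding Q.signed_sum_second_moment[symmetric]
    by (intro suminf_cong nn_integral_eq_integral Q.bounded_rv_integrable Q.bounded_rv_power Q.bounded_rv_signed_sum) auto
  also have "\<dots> \<le> (\<Sum>i. \<Sum>j. ennreal ((a i j)\<^sup>2))"
  proof (intro suminf_le)
    fix i
    have "ennreal (\<Sum>j<k i. (a i j)\<^sup>2) = (\<Sum>j<k i. ennreal ((a i j)\<^sup>2))" by simp
    also have "\<dots> \<le> (\<Sum>j. ennreal ((a i j)\<^sup>2))" by (intro sum_le_suminf) auto
    finally show "ennreal (\<Sum>j<k i. (a i j)\<^sup>2) \<le> (\<Sum>j. ennreal ((a i j)\<^sup>2))" .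
  qed auto
  finally have "(\<integral>\<^sup>+\<omega>'. (\<Sum>i. ennreal ((Q.signed_sum (a i) (k i) \<omega>')\<^sup>2)) \<partial>Q) \<noteq> \<infinity>" using fin by auto
  then have "AE \<omega>' in Q. (\<Sum>i. ennreal ((Q.signed_sum (a i) (k i) \<omega>')\<^sup>2)) \<noteq> \<infinity>"
    by (intro nn_integral_noteq_infinite) measurable
  then have "AE \<omega>' in Q. AE \<omega> in P. C \<omega> \<omega>'"
  proof eventually_elim
    case (elim \<omega>')
    have "summable (\<lambda>i. (Q.signed_sum (a i) (k i) \<omega>')\<^sup>2)"
      using elim by (intro summable_suminf_not_top) auto
    from P.rademacher_series_convergent[OF this] show ?case
      by (simp add: C_def P.signed_sum_def Q.signed_sum_def mult.commute)
  qed
  then have "AE z in P \<Otimes>\<^sub>M Q. C (fst z) (snd z)"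
    using PQ.AE_commute[of C, OF meas] PQ.AE_pair_iff[of C, OF meas] by blast
  then show ?thesis by (simp add: C_def)
qed

lemma chaos_convergent_if_square_summable:
  fixes a :: "nat \<Rightarrow> nat \<Rightarrow> real"
  assumes fin: "(\<Sum>i. \<Sum>j. ennreal ((a i j)\<^sup>2)) < \<infinity>"
  shows "AE z in P \<Otimes>\<^sub>M Q. convergent (\<lambda>n. \<Sum>i<n. \<Sum>j<n. e1 i (fst z) * e2 j (snd z) * a i j)"
proof -
  interpret S: two_rademacher_sequences Q e2 P e1 ..
  have "(\<Sum>j. \<Sum>i. ennreal ((a i j)\<^sup>2)) < \<infinity>" using fin by (subst suminf_ennreal_swap)
  note S.row_finite_chaos_convergent[OF this, of "\<lambda>j. j"]
  moreover define C where "C \<omega> \<omega>' = convergent (\<lambda>n. \<Sum>j<n. e2 j \<omega>' * (\<Sum>i<j. a i j * e1 i \<omega>))" for \<omega> \<omega>'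
  ultimately have "AE \<omega>' in Q. AE \<omega> in P. C \<omega> \<omega>'"
    by (auto dest: S.PQ.AE_pair)
  moreover have meas: "{z \<in> space (P \<Otimes>\<^sub>M Q). C (fst z) (snd z)} \<in> sets (P \<Otimes>\<^sub>M Q)"
    unfolding C_def by (intro convergent_measurable) measurable
  ultimately have "AE z in P \<Otimes>\<^sub>M Q. C (fst z) (snd z)"
    using PQ.AE_commute[of C, OF meas] PQ.AE_pair_iff[of C, OF meas] by blast
  with row_finite_chaos_convergent[OF fin, of Suc] show ?thesis
  proof eventually_elim
    case (elim z)
    then show ?case unfolding square_chaos_expand C_def by (rule convergent_add)
  qed
qed

text \<open>The Paley--Zygmund principle is applied twice: for fixed \<open>\<omega>'\<close> to the squares of the chaos, whose means are \<open>W n \<omega>'\<close>, and then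
to \<open>W n\<close> itself, whose mean is the sum of the \<open>(a i j)\<^sup>2\<close> over \<open>i, j < n\<close>.\<close>

lemma square_summable_if_chaos_convergent:
  fixes a :: "nat \<Rightarrow> nat \<Rightarrow> real"
  assumes conv: "AE z in P \<Otimes>\<^sub>M Q. convergent (\<lambda>n. \<Sum>i<n. \<Sum>j<n. e1 i (fst z) * e2 j (snd z) * a i j)"
  shows "(\<Sum>i. \<Sum>j. ennreal ((a i j)\<^sup>2)) < \<infinity>"
proof -
  define S where "S n \<omega> \<omega>' = (\<Sum>i<n. \<Sum>j<n. e1 i \<omega> * e2 j \<omega>' * a i j)" for n \<omega> \<omega>'
  have S_signed_sum: "S n \<omega> \<omega>' = P.signed_sum (\<lambda>i. Q.signed_sum (a i) n \<omega>') n \<omega>" for n \<omega> \<omega>'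
    by (simp add: S_def P.signed_sum_def Q.signed_sum_def sum_distrib_left sum_distrib_right mult_ac)
  define W where "W n \<omega>' = (\<Sum>i<n. (Q.signed_sum (a i) n \<omega>')\<^sup>2)" for n \<omega>'
  define C where "C \<omega> \<omega>' = convergent (\<lambda>n. S n \<omega> \<omega>')" for \<omega> \<omega>'
  have meas: "{z \<in> space (P \<Otimes>\<^sub>M Q). C (fst z) (snd z)} \<in> sets (P \<Otimes>\<^sub>M Q)"
    unfolding C_def S_def by (intro convergent_measurable) measurable
  have "AE z in P \<Otimes>\<^sub>M Q. C (fst z) (snd z)" using conv by (simp add: C_def S_def)
  then have "AE \<omega>' in Q. AE \<omega> in P. C \<omega> \<omega>'"
    using PQ.AE_commute[of C, OF meas] PQ.AE_pair_iff[of C, OF meas] by blast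
  then have W_bounded: "AE \<omega>' in Q. \<exists>B. \<forall>n. W n \<omega>' \<le> B"
  proof eventually_elim
    case (elim \<omega>')
    have m2: "P.expectation (\<lambda>\<omega>. (S n \<omega> \<omega>')\<^sup>2) = W n \<omega>'" for n
      unfolding S_signed_sum W_def by (rule P.signed_sum_second_moment)
    have "\<exists>B. \<forall>n. P.expectation (\<lambda>\<omega>. (S n \<omega> \<omega>')\<^sup>2) \<le> B"
    proof (rule P.bounded_expectation_if_AE_bounded[where K=3])
      show "(\<lambda>\<omega>. (S n \<omega> \<omega>')\<^sup>2) \<in> borel_measurable P" for n unfolding S_signed_sum by measurable
      show "integrable P (\<lambda>\<omega>. ((S n \<omega> \<omega>')\<^sup>2)\<^sup>2)" for n
        unfolding S_signed_sum by (intro P.bounded_rv_integrable P.bounded_rv_power P.bounded_rv_signed_sum)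
      show "P.expectation (\<lambda>\<omega>. ((S n \<omega> \<omega>')\<^sup>2)\<^sup>2)
          \<le> 3 * (P.expectation (\<lambda>\<omega>. (S n \<omega> \<omega>')\<^sup>2) + (P.expectation (\<lambda>\<omega>. (S n \<omega> \<omega>')\<^sup>2))\<^sup>2)" for n
      proof -
        have "P.expectation (\<lambda>\<omega>. ((S n \<omega> \<omega>')\<^sup>2)\<^sup>2) \<le> 3 * (W n \<omega>')\<^sup>2"
          using P.signed_sum_mixed_fourth_moment[of "\<lambda>i. Q.signed_sum (a i) n \<omega>'" n "\<lambda>i. Q.signed_sum (a i) n \<omega>'"]
          unfolding S_signed_sum W_def by (simp add: power2_eq_square)
        also have "\<dots> \<le> 3 * (W n \<omega>' + (W n \<omega>')\<^sup>2)" by (simp add: W_def sum_nonneg)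
        finally show ?thesis unfolding m2 .
      qed
      show "AE \<omega> in P. \<exists>B. \<forall>n. (S n \<omega> \<omega>')\<^sup>2 \<le> B"
        using elim
      proof eventually_elim
        case (elim \<omega>)
        then obtain B where B: "\<And>n. \<bar>S n \<omega> \<omega>'\<bar> \<le> B"
          using convergent_imp_Bseq[OF elim[unfolded C_def]] by (auto simp: Bseq_def)
        have "(S n \<omega> \<omega>')\<^sup>2 \<le> B\<^sup>2" for n using power_mono[OF B, of n 2] by simp
        then show ?case by blast
      qed
    qed simp
    then show ?case by (simp add: m2)
  qed
  define V where "V i n = (\<Sum>j<n. (a i j)\<^sup>2)" for i n
  have EW: "Q.expectation (W n) = (\<Sum>i<n. V i n)" for n
  proof -
    have "Q.expectation (W n) = (\<Sum>i<n. Q.expectation (\<lambda>\<omega>'. (Q.signed_sum (a i) n \<omega>')\<^sup>2))"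
      unfolding W_def[abs_def]
      by (intro Bochner_Integration.integral_sum Q.bounded_rv_integrable Q.bounded_rv_power Q.bounded_rv_signed_sum)
    then show ?thesis by (simp add: V_def Q.signed_sum_second_moment)
  qed
  have "\<exists>B. \<forall>n. Q.expectation (W n) \<le> B"
  proof (rule Q.bounded_expectation_if_AE_bounded[where K=3, OF _ _ _ W_bounded])
    have bW: "Q.bounded_rv (W n)" for n
      unfolding W_def[abs_def] by (intro Q.bounded_rv_intros Q.bounded_rv_signed_sum)
    then show "W n \<in> borel_measurable Q" for n by (simp add: Q.bounded_rv_def)
    show "integrable Q (\<lambda>\<omega>'. (W n \<omega>')\<^sup>2)" for n
      by (intro Q.bounded_rv_integrable Q.bounded_rv_power bW)
    show "Q.expectation (\<lambda>\<omega>'. (W n \<omega>')\<^sup>2) \<le> 3 * (Q.expectation (W n) + (Q.expectation (W n))\<^sup>2)" for n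
    proof -
      have "Q.expectation (\<lambda>\<omega>'. (W n \<omega>')\<^sup>2)
          = Q.expectation (\<lambda>\<omega>'. \<Sum>i<n. \<Sum>k<n. (Q.signed_sum (a i) n \<omega>')\<^sup>2 * (Q.signed_sum (a k) n \<omega>')\<^sup>2)"
        unfolding W_def power2_eq_square[of "sum _ _"] by (simp add: sum_product)
      also have "\<dots> = (\<Sum>i<n. \<Sum>k<n. Q.expectation (\<lambda>\<omega>'. (Q.signed_sum (a i) n \<omega>')\<^sup>2 * (Q.signed_sum (a k) n \<omega>')\<^sup>2))"
        by (subst Bochner_Integration.integral_sum
            | intro sum.cong refl Q.bounded_rv_integrable Q.bounded_rv_intros Q.bounded_rv_signed_sum)+
      also have "\<dots> \<le> (\<Sum>i<n. \<Sum>k<n. 3 * V i n * V k n)"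
        unfolding V_def by (intro sum_mono Q.signed_sum_mixed_fourth_moment)
      also have "\<dots> = 3 * (Q.expectation (W n))\<^sup>2"
        unfolding EW power2_eq_square sum_product by (simp add: sum_distrib_left mult.assoc)
      also have "\<dots> \<le> 3 * (Q.expectation (W n) + (Q.expectation (W n))\<^sup>2)"
        by (simp add: EW V_def sum_nonneg)
      finally show ?thesis .
    qed
  qed simp
  then obtain B where "\<And>n. (\<Sum>i<n. \<Sum>j<n. (a i j)\<^sup>2) \<le> B" by (auto simp: EW V_def)
  then show ?thesis by (rule suminf_suminf_finite_if_square_sums_le) simp
qed

theorem chaos_convergent_iff:
  fixes a :: "nat \<Rightarrow> nat \<Rightarrow> real"
  shows "(AE z in P \<Otimes>\<^sub>M Q. convergent (\<lambda>n. \<Sum>i<n. \<Sum>j<n. e1 i (fst z) * e2 j (snd z) * a i j))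
    \<longleftrightarrow> (\<Sum>i. \<Sum>j. ennreal ((a i j)\<^sup>2)) < \<infinity>"
  using chaos_convergent_if_square_summable square_summable_if_chaos_convergent by blast

end

section \<open>Independence as a change of probability space\<close>

text \<open>Independence of \<open>U\<close> and \<open>V\<close>, expressed as equality of the joint law with the law of \<open>U\<close> and \<open>V\<close> evaluated at
independent points of the sample space. Unlike \<open>indep_var\<close>, it relates variables with values in different types.\<close>

definition (in prob_space) decouples ::
  "'s measure \<Rightarrow> ('a \<Rightarrow> 's) \<Rightarrow> 't measure \<Rightarrow> ('a \<Rightarrow> 't) \<Rightarrow> bool" where
  "decouples S U T V \<longleftrightarrow> U \<in> measurable M S \<and> V \<in> measurable M T \<and>
    distr M (S \<Otimes>\<^sub>M T) (\<lambda>\<omega>. (U \<omega>, V \<omega>)) = distr (M \<Otimes>\<^sub>M M) (S \<Otimes>\<^sub>M T) (\<lambda>z. (U (fst z), V (snd z)))"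

lemma (in prob_space) decouples_if_indep_var:
  assumes indep: "indep_var S U T V"
  shows "decouples S U T V"
proof -
  have [measurable]: "U \<in> measurable M S" "V \<in> measurable M T"
    using indep by (auto simp: indep_var_distribution_eq)
  interpret T: prob_space "distr M T V" by (rule prob_space_distr) measurable
  have "distr M (S \<Otimes>\<^sub>M T) (\<lambda>\<omega>. (U \<omega>, V \<omega>)) = distr M S U \<Otimes>\<^sub>M distr M T V"
    using indep by (simp add: indep_var_distribution_eq)
  also have "\<dots> = distr (M \<Otimes>\<^sub>M M) (S \<Otimes>\<^sub>M T) (\<lambda>(x, y). (U x, V y))"
    by (rule pair_measure_distr) (auto intro: T.sigma_finite_measure_axioms)
  finally show ?thesis by (simp add: case_prod_unfold decouples_def)
qed

lemma (in prob_space) decouples_compose: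
  assumes dec: "decouples S U T V"
    and [measurable]: "f \<in> measurable S S'" "g \<in> measurable T T'"
  shows "decouples S' (\<lambda>\<omega>. f (U \<omega>)) T' (\<lambda>\<omega>. g (V \<omega>))"
proof -
  have [measurable]: "U \<in> measurable M S" "V \<in> measurable M T"
    using dec by (auto simp: decouples_def)
  have "distr M (S' \<Otimes>\<^sub>M T') (\<lambda>\<omega>. (f (U \<omega>), g (V \<omega>)))
      = distr (distr M (S \<Otimes>\<^sub>M T) (\<lambda>\<omega>. (U \<omega>, V \<omega>))) (S' \<Otimes>\<^sub>M T') (\<lambda>z. (f (fst z), g (snd z)))"
    by (subst distr_distr) (auto simp: comp_def)
  also have "distr M (S \<Otimes>\<^sub>M T) (\<lambda>\<omega>. (U \<omega>, V \<omega>))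
      = distr (M \<Otimes>\<^sub>M M) (S \<Otimes>\<^sub>M T) (\<lambda>z. (U (fst z), V (snd z)))"
    using dec by (simp add: decouples_def)
  also have "distr (distr (M \<Otimes>\<^sub>M M) (S \<Otimes>\<^sub>M T) (\<lambda>z. (U (fst z), V (snd z)))) (S' \<Otimes>\<^sub>M T') (\<lambda>z. (f (fst z), g (snd z)))
      = distr (M \<Otimes>\<^sub>M M) (S' \<Otimes>\<^sub>M T') (\<lambda>z. (f (U (fst z)), g (V (snd z))))"
    by (subst distr_distr) (auto simp: comp_def)
  finally show ?thesis by (simp add: decouples_def)
qed

lemma (in prob_space) AE_decouples_iff:
  assumes dec: "decouples S U T V"
    and R[measurable]: "{z \<in> space (S \<Otimes>\<^sub>M T). R (fst z) (snd z)} \<in> sets (S \<Otimes>\<^sub>M T)"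
  shows "(AE \<omega> in M. R (U \<omega>) (V \<omega>)) \<longleftrightarrow> (AE z in M \<Otimes>\<^sub>M M. R (U (fst z)) (V (snd z)))"
proof -
  have [measurable]: "U \<in> measurable M S" "V \<in> measurable M T"
    using dec by (auto simp: decouples_def)
  have "(AE \<omega> in M. R (U \<omega>) (V \<omega>)) \<longleftrightarrow> (AE z in distr M (S \<Otimes>\<^sub>M T) (\<lambda>\<omega>. (U \<omega>, V \<omega>)). R (fst z) (snd z))"
    by (subst AE_distr_iff) auto
  also have "distr M (S \<Otimes>\<^sub>M T) (\<lambda>\<omega>. (U \<omega>, V \<omega>))
      = distr (M \<Otimes>\<^sub>M M) (S \<Otimes>\<^sub>M T) (\<lambda>z. (U (fst z), V (snd z)))"
    using dec by (simp add: decouples_def)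
  also have "(AE z in distr (M \<Otimes>\<^sub>M M) (S \<Otimes>\<^sub>M T) (\<lambda>z. (U (fst z), V (snd z))). R (fst z) (snd z))
      \<longleftrightarrow> (AE z in M \<Otimes>\<^sub>M M. R (U (fst z)) (V (snd z)))"
    by (subst AE_distr_iff) auto
  finally show ?thesis .
qed

lemma (in prob_space) nn_integral_decouples:
  assumes dec: "decouples S U T V" and g[measurable]: "g \<in> borel_measurable (S \<Otimes>\<^sub>M T)"
  shows "(\<integral>\<^sup>+\<omega>. g (U \<omega>, V \<omega>) \<partial>M) = (\<integral>\<^sup>+z. g (U (fst z), V (snd z)) \<partial>(M \<Otimes>\<^sub>M M))"
proof -
  have [measurable]: "U \<in> measurable M S" "V \<in> measurable M T"
    using dec by (auto simp: decouples_def)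
  have "(\<integral>\<^sup>+\<omega>. g (U \<omega>, V \<omega>) \<partial>M) = (\<integral>\<^sup>+z. g z \<partial>distr M (S \<Otimes>\<^sub>M T) (\<lambda>\<omega>. (U \<omega>, V \<omega>)))"
    by (subst nn_integral_distr) auto
  also have "distr M (S \<Otimes>\<^sub>M T) (\<lambda>\<omega>. (U \<omega>, V \<omega>))
      = distr (M \<Otimes>\<^sub>M M) (S \<Otimes>\<^sub>M T) (\<lambda>z. (U (fst z), V (snd z)))"
    using dec by (simp add: decouples_def)
  also have "(\<integral>\<^sup>+z. g z \<partial>distr (M \<Otimes>\<^sub>M M) (S \<Otimes>\<^sub>M T) (\<lambda>z. (U (fst z), V (snd z))))
      = (\<integral>\<^sup>+z. g (U (fst z), V (snd z)) \<partial>(M \<Otimes>\<^sub>M M))"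
    by (subst nn_integral_distr) auto
  finally show ?thesis .
qed

definition sign_of :: "real \<Rightarrow> real" where "sign_of x = (if x = 1 then 1 else - 1)"

lemma sign_of_measurable [measurable]: "sign_of \<in> borel_measurable borel"
  unfolding sign_of_def[abs_def] by measurable

context decoupled_rademacher
begin

lemmas [measurable] = measurable_X measurable_Y measurable_eps1 measurable_eps2

text \<open>All variables as one family with values in a single space, to which the theory of independent families applies.
Each variable occupies one component of the pair and the other component is constant.\<close>

definition coded :: "var_index \<Rightarrow> 'a \<Rightarrow> 'e \<times> real" where
  "coded k \<omega> = (case k of
      VX i \<Rightarrow> (X i \<omega>, 0)
    | VY j \<Rightarrow> (Y j \<omega>, 0)
    | VEps1 i \<Rightarrow> (SOME x. x \<in> space E, \<epsilon>1 i \<omega>)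
    | VEps2 j \<Rightarrow> (SOME x. x \<in> space E, \<epsilon>2 j \<omega>))"

lemma some_in_space_E: "(SOME x. x \<in> space E) \<in> space E"
proof -
  obtain \<omega> where "\<omega> \<in> space M" using not_empty by blast
  then have "X 0 \<omega> \<in> space E" by (rule measurable_space[OF measurable_X])
  then show ?thesis by (rule someI)
qed

lemma indep_coded: "indep_vars (\<lambda>_. E \<Otimes>\<^sub>M borel) coded UNIV"
  unfolding indep_vars_def2
proof (intro conjI ballI)
  note [measurable] = some_in_space_E
  show "random_variable (E \<Otimes>\<^sub>M borel) (coded k)" for k
    unfolding coded_def[abs_def] by (cases k) simp_all
  have sub: "{Z -` A \<inter> space M |A. A \<in> sets N} \<subseteq> sets (vimage_algebra (space M) V K)"
    if "Z \<in> measurable (vimage_algebra (space M) V K) N" for Z :: "'a \<Rightarrow> 'e \<times> real" and V :: "'a \<Rightarrow> 'v" and N K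
    using measurable_sets[OF that] by auto
  have X: "X i \<in> measurable (vimage_algebra (space M) (X i) E) E"
    and Y: "Y i \<in> measurable (vimage_algebra (space M) (Y i) E) E"
    and e1: "\<epsilon>1 i \<in> borel_measurable (vimage_algebra (space M) (\<epsilon>1 i) borel)"
    and e2: "\<epsilon>2 i \<in> borel_measurable (vimage_algebra (space M) (\<epsilon>2 i) borel)" for i
    by (auto intro!: measurable_vimage_algebra1 measurable_space[OF measurable_X] measurable_space[OF measurable_Y])
  show "indep_sets (\<lambda>k. {coded k -` A \<inter> space M |A. A \<in> sets (E \<Otimes>\<^sub>M borel)}) UNIV"
  proof (rule indep_sets_mono_sets[OF indep_all])
    fix k
    show "{coded k -` A \<inter> space M |A. A \<in> sets (E \<Otimes>\<^sub>M borel)} \<subseteq> (case k of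
           VX i \<Rightarrow> sets (vimage_algebra (space M) (X i) E)
         | VY j \<Rightarrow> sets (vimage_algebra (space M) (Y j) E)
         | VEps1 i \<Rightarrow> sets (vimage_algebra (space M) (\<epsilon>1 i) borel)
         | VEps2 j \<Rightarrow> sets (vimage_algebra (space M) (\<epsilon>2 j) borel))"
    proof (cases k)
      case (VX i)
      have "coded k \<in> measurable (vimage_algebra (space M) (X i) E) (E \<Otimes>\<^sub>M borel)"
        using X[of i] by (simp add: coded_def[abs_def] VX)
      then show ?thesis unfolding VX by (simp add: sub)
    next
      case (VY i)
      have "coded k \<in> measurable (vimage_algebra (space M) (Y i) E) (E \<Otimes>\<^sub>M borel)"
        using Y[of i] by (simp add: coded_def[abs_def] VY)
      then show ?thesis unfolding VY by (simp add: sub)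
    next
      case (VEps1 i)
      have "coded k \<in> measurable (vimage_algebra (space M) (\<epsilon>1 i) borel) (E \<Otimes>\<^sub>M borel)"
        using e1[of i] by (simp add: coded_def[abs_def] VEps1)
      then show ?thesis unfolding VEps1 by (simp add: sub)
    next
      case (VEps2 i)
      have "coded k \<in> measurable (vimage_algebra (space M) (\<epsilon>2 i) borel) (E \<Otimes>\<^sub>M borel)"
        using e2[of i] by (simp add: coded_def[abs_def] VEps2)
      then show ?thesis unfolding VEps2 by (simp add: sub)
    qed
  qed
qed

lemma indep_vars_coded_family:
  assumes inj: "inj c" and g: "g \<in> measurable (E \<Otimes>\<^sub>M borel) N"
  shows "indep_vars (\<lambda>_. N) (\<lambda>i \<omega>. g (coded (c i) \<omega>)) UNIV"
proof -
  have "indep_vars (\<lambda>i. PiM {c i} (\<lambda>_. E \<Otimes>\<^sub>M borel)) (\<lambda>i \<omega>. restrict (\<lambda>k. coded k \<omega>) {c i}) UNIV"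
    using inj by (intro indep_vars_restrict[OF indep_coded]) (auto simp: disjoint_family_on_def inj_def)
  then have "indep_vars (\<lambda>_. N) (\<lambda>i \<omega>. g (restrict (\<lambda>k. coded k \<omega>) {c i} (c i))) UNIV"
    by (rule indep_vars_compose2)
      (auto intro!: measurable_compose[OF _ g] measurable_component_singleton)
  then show ?thesis by simp
qed

text \<open>The functions take the whole family as argument, and their dependence on a block is expressed by invariance under
restriction to it; this avoids restricted families in the instances below.\<close>

lemma decouples_coded_blocks:
  assumes disj: "K \<inter> L = {}"
    and f: "f \<in> measurable (PiM K (\<lambda>_. E \<Otimes>\<^sub>M borel)) S" "\<And>e. f (restrict e K) = f e"
    and g: "g \<in> measurable (PiM L (\<lambda>_. E \<Otimes>\<^sub>M borel)) T" "\<And>e. g (restrict e L) = g e"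
  shows "decouples S (\<lambda>\<omega>. f (\<lambda>k. coded k \<omega>)) T (\<lambda>\<omega>. g (\<lambda>k. coded k \<omega>))"
proof -
  have "decouples (PiM K (\<lambda>_. E \<Otimes>\<^sub>M borel)) (\<lambda>\<omega>. restrict (\<lambda>k. coded k \<omega>) K)
      (PiM L (\<lambda>_. E \<Otimes>\<^sub>M borel)) (\<lambda>\<omega>. restrict (\<lambda>k. coded k \<omega>) L)"
    using disj by (intro decouples_if_indep_var indep_var_restrict[OF indep_coded]) auto
  from decouples_compose[OF this f(1) g(1)] show ?thesis by (simp only: f(2) g(2))
qed

definition sign1 :: "nat \<Rightarrow> 'a \<Rightarrow> real" where "sign1 i \<omega> = sign_of (\<epsilon>1 i \<omega>)"
definition sign2 :: "nat \<Rightarrow> 'a \<Rightarrow> real" where "sign2 i \<omega> = sign_of (\<epsilon>2 i \<omega>)"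

lemma coordinate_measurable:
  "k \<in> K \<Longrightarrow> (\<lambda>e. e k) \<in> measurable (PiM K (\<lambda>_. E \<Otimes>\<^sub>M borel)) (E \<Otimes>\<^sub>M (borel :: real measure))"
  by (rule measurable_component_singleton)

lemma decouples_X_Y: "decouples (PiM UNIV (\<lambda>_. E)) (\<lambda>\<omega> i. X i \<omega>) (PiM UNIV (\<lambda>_. E)) (\<lambda>\<omega> j. Y j \<omega>)"
  using decouples_coded_blocks[of "range VX" "range VY" "\<lambda>e i. fst (e (VX i))" "PiM UNIV (\<lambda>_. E)"
      "\<lambda>e j. fst (e (VY j))" "PiM UNIV (\<lambda>_. E)"]
  by (force simp: coded_def intro!: measurable_abs_UNIV measurable_compose[OF coordinate_measurable])

lemma decouples_sign1_sign2:
  "decouples (PiM UNIV (\<lambda>_. borel)) (\<lambda>\<omega> i. sign1 i \<omega>) (PiM UNIV (\<lambda>_. borel)) (\<lambda>\<omega> j. sign2 j \<omega>)"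
  using decouples_coded_blocks[of "range VEps1" "range VEps2" "\<lambda>e i. sign_of (snd (e (VEps1 i)))" "PiM UNIV (\<lambda>_. borel)"
      "\<lambda>e j. sign_of (snd (e (VEps2 j)))" "PiM UNIV (\<lambda>_. borel)"]
  by (force simp: coded_def sign1_def sign2_def intro!: measurable_abs_UNIV measurable_compose[OF coordinate_measurable])

lemma decouples_variables_signs:
  "decouples (PiM UNIV (\<lambda>_. E) \<Otimes>\<^sub>M PiM UNIV (\<lambda>_. E)) (\<lambda>\<omega>. (\<lambda>i. X i \<omega>, \<lambda>j. Y j \<omega>))
    (PiM UNIV (\<lambda>_. borel) \<Otimes>\<^sub>M PiM UNIV (\<lambda>_. borel)) (\<lambda>\<omega>. (\<lambda>i. sign1 i \<omega>, \<lambda>j. sign2 j \<omega>))"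
  using decouples_coded_blocks[of "range VX \<union> range VY" "range VEps1 \<union> range VEps2"
      "\<lambda>e. (\<lambda>i. fst (e (VX i)), \<lambda>j. fst (e (VY j)))" "PiM UNIV (\<lambda>_. E) \<Otimes>\<^sub>M PiM UNIV (\<lambda>_. E)"
      "\<lambda>e. (\<lambda>i. sign_of (snd (e (VEps1 i))), \<lambda>j. sign_of (snd (e (VEps2 j))))"
      "PiM UNIV (\<lambda>_. borel) \<Otimes>\<^sub>M PiM UNIV (\<lambda>_. borel)"]
  by (force simp: coded_def sign1_def sign2_def
      intro!: measurable_Pair measurable_abs_UNIV measurable_compose[OF coordinate_measurable])

lemma expectation_sign_of:
  assumes [measurable]: "e \<in> borel_measurable M"
    and "prob {\<omega> \<in> space M. e \<omega> = 1} = 1/2"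
  shows "expectation (\<lambda>\<omega>. sign_of (e \<omega>)) = 0"
proof -
  have i: "integrable M (indicat_real {\<omega> \<in> space M. e \<omega> = 1})"
    by (intro integrable_const_bound[where B=1]) (auto simp: indicator_def)
  have "expectation (\<lambda>\<omega>. sign_of (e \<omega>)) = expectation (\<lambda>\<omega>. 2 * indicat_real {\<omega> \<in> space M. e \<omega> = 1} \<omega> - 1)"
    by (intro Bochner_Integration.integral_cong) (auto simp: sign_of_def indicator_def)
  also have "\<dots> = 0" using i assms(2) by (simp add: prob_space)
  finally show ?thesis .
qed

lemma AE_sign_of_eq:
  assumes [measurable]: "e \<in> borel_measurable M"
    and p: "prob {\<omega> \<in> space M. e \<omega> = 1} = 1/2" "prob {\<omega> \<in> space M. e \<omega> = - 1} = 1/2"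
  shows "AE \<omega> in M. sign_of (e \<omega>) = e \<omega>"
proof -
  have "prob ({\<omega> \<in> space M. e \<omega> = 1} \<union> {\<omega> \<in> space M. e \<omega> = - 1})
      = prob {\<omega> \<in> space M. e \<omega> = 1} + prob {\<omega> \<in> space M. e \<omega> = - 1}"
    by (intro finite_measure_Union) auto
  then have "prob ({\<omega> \<in> space M. e \<omega> = 1} \<union> {\<omega> \<in> space M. e \<omega> = - 1}) = 1" using p by simp
  then have "AE \<omega> in M. \<omega> \<in> {\<omega> \<in> space M. e \<omega> = 1} \<union> {\<omega> \<in> space M. e \<omega> = - 1}"
    by (rule AE_prob_1)
  then show ?thesis by eventually_elim (auto simp: sign_of_def)
qed

lemma rademacher_sign1: "rademacher_sequence M sign1"
proof
  show "indep_vars (\<lambda>_. borel) sign1 UNIV"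
    using indep_vars_coded_family[of VEps1 "\<lambda>z. sign_of (snd z)" borel]
    by (simp add: inj_def coded_def sign1_def[abs_def])
  show "expectation (sign1 i) = 0" for i
    unfolding sign1_def[abs_def] by (intro expectation_sign_of rademacher_eps1) measurable
qed (auto simp: sign1_def sign_of_def)

lemma rademacher_sign2: "rademacher_sequence M sign2"
proof
  show "indep_vars (\<lambda>_. borel) sign2 UNIV"
    using indep_vars_coded_family[of VEps2 "\<lambda>z. sign_of (snd z)" borel]
    by (simp add: inj_def coded_def sign2_def[abs_def])
  show "expectation (sign2 i) = 0" for i
    unfolding sign2_def[abs_def] by (intro expectation_sign_of rademacher_eps2) measurable
qed (auto simp: sign2_def sign_of_def)

lemma AE_signs_eq: "AE \<omega> in M. \<forall>i. sign1 i \<omega> = \<epsilon>1 i \<omega> \<and> sign2 i \<omega> = \<epsilon>2 i \<omega>"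
  unfolding sign1_def sign2_def
  by (subst AE_all_countable)
    (auto intro!: AE_conjI AE_sign_of_eq rademacher_eps1 rademacher_eps2)

text \<open>The signs are separated from \<open>X\<close> and \<open>Y\<close> first, and for each fixed matrix from each other, which reduces the claim
to the deterministic criterion \<open>chaos_convergent_iff\<close>.\<close>

theorem chaos_convergent_iff_square_summable:
  assumes [measurable]: "\<And>i j. h i j \<in> borel_measurable (E \<Otimes>\<^sub>M E)"
  shows "(AE \<omega> in M. convergent (\<lambda>n. \<Sum>i<n. \<Sum>j<n. \<epsilon>1 i \<omega> * \<epsilon>2 j \<omega> * h i j (X i \<omega>, Y j \<omega>)))
    \<longleftrightarrow> (AE \<omega> in M. (\<Sum>i. \<Sum>j. ennreal ((h i j (X i \<omega>, Y j \<omega>))\<^sup>2)) < \<infinity>)"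
proof -
  interpret R: two_rademacher_sequences M sign1 M sign2
    by (simp add: two_rademacher_sequences_def rademacher_sign1 rademacher_sign2)
  define conv where "conv xy s = convergent (\<lambda>n. \<Sum>i<n. \<Sum>j<n. fst s i * snd s j * h i j (fst xy i, snd xy j))"
    for xy :: "(nat \<Rightarrow> 'e) \<times> (nat \<Rightarrow> 'e)" and s :: "(nat \<Rightarrow> real) \<times> (nat \<Rightarrow> real)"
  define V where "V \<omega> = (\<lambda>i. X i \<omega>, \<lambda>j. Y j \<omega>)" for \<omega>
  define s where "s \<omega> = (\<lambda>i. sign1 i \<omega>, \<lambda>j. sign2 j \<omega>)" for \<omega>
  have dec: "decouples (PiM UNIV (\<lambda>_. E) \<Otimes>\<^sub>M PiM UNIV (\<lambda>_. E)) V (PiM UNIV (\<lambda>_. borel) \<Otimes>\<^sub>M PiM UNIV (\<lambda>_. borel)) s"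
    using decouples_variables_signs by (simp add: V_def[abs_def] s_def[abs_def])
  then have [measurable]: "V \<in> measurable M (PiM UNIV (\<lambda>_. E) \<Otimes>\<^sub>M PiM UNIV (\<lambda>_. E))"
      "s \<in> measurable M (PiM UNIV (\<lambda>_. borel) \<Otimes>\<^sub>M PiM UNIV (\<lambda>_. borel))"
    by (auto simp: decouples_def)
  have "(AE \<omega> in M. convergent (\<lambda>n. \<Sum>i<n. \<Sum>j<n. \<epsilon>1 i \<omega> * \<epsilon>2 j \<omega> * h i j (X i \<omega>, Y j \<omega>)))
      \<longleftrightarrow> (AE \<omega> in M. conv (V \<omega>) (s \<omega>))"
    by (rule eventually_subst) (use AE_signs_eq in eventually_elim, simp add: conv_def V_def s_def)
  also have "\<dots> \<longleftrightarrow> (AE z in M \<Otimes>\<^sub>M M. conv (V (fst z)) (s (snd z)))"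
    unfolding conv_def by (rule AE_decouples_iff[OF dec]) (intro convergent_measurable, measurable)
  also have "\<dots> \<longleftrightarrow> (AE \<omega> in M. AE \<omega>' in M. conv (V \<omega>) (s \<omega>'))"
    unfolding conv_def by (rule R.PQ.AE_pair_iff[symmetric]) (intro convergent_measurable, measurable)
  also have "\<dots> \<longleftrightarrow> (AE \<omega> in M. (\<Sum>i. \<Sum>j. ennreal ((h i j (X i \<omega>, Y j \<omega>))\<^sup>2)) < \<infinity>)"
  proof -
    have "(AE \<omega>' in M. conv (V \<omega>) (s \<omega>')) \<longleftrightarrow> (\<Sum>i. \<Sum>j. ennreal ((h i j (X i \<omega>, Y j \<omega>))\<^sup>2)) < \<infinity>" for \<omega>
    proof -
      define Cv where "Cv e e' = convergent (\<lambda>n. \<Sum>i<n. \<Sum>j<n. e i * e' j * h i j (X i \<omega>, Y j \<omega>))"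
        for e e' :: "nat \<Rightarrow> real"
      have "(AE \<omega>' in M. conv (V \<omega>) (s \<omega>')) \<longleftrightarrow> (AE \<omega>' in M. Cv (\<lambda>i. sign1 i \<omega>') (\<lambda>j. sign2 j \<omega>'))"
        by (simp add: conv_def Cv_def V_def s_def)
      also have "\<dots> \<longleftrightarrow> (AE z in M \<Otimes>\<^sub>M M. Cv (\<lambda>i. sign1 i (fst z)) (\<lambda>j. sign2 j (snd z)))"
        by (rule AE_decouples_iff[OF decouples_sign1_sign2, of Cv])
          (unfold Cv_def, intro convergent_measurable, measurable)
      also have "\<dots> \<longleftrightarrow> (\<Sum>i. \<Sum>j. ennreal ((h i j (X i \<omega>, Y j \<omega>))\<^sup>2)) < \<infinity>"
        unfolding Cv_def by (rule R.chaos_convergent_iff)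
      finally show ?thesis .
    qed
    then show ?thesis by simp
  qed
  finally show ?thesis .
qed

text \<open>Both copies of the sample space carry the same measure, so the row and column means of the kernel
\<open>min (h\<^sup>2) 1\<close> are literally \<open>row_sum\<close> and \<open>col_sum\<close>.\<close>

theorem square_summable_iff:
  fixes h :: "nat \<Rightarrow> nat \<Rightarrow> 'e \<times> 'e \<Rightarrow> real"
  assumes [measurable]: "\<And>i j. h i j \<in> borel_measurable (E \<Otimes>\<^sub>M E)"
  defines "c \<equiv> row_sum M Y h" and "d \<equiv> col_sum M X h"
  shows "(AE \<omega> in M. (\<Sum>i. \<Sum>j. ennreal ((h i j (X i \<omega>, Y j \<omega>))\<^sup>2)) < \<infinity>) \<longleftrightarrow>
    ((\<forall>i. AE \<omega> in M. c i (X i \<omega>) < \<infinity>) \<and> (\<forall>j. AE \<omega> in M. d j (Y j \<omega>) < \<infinity>)) \<and>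
    ((\<Sum>i. emeasure M {\<omega> \<in> space M. c i (X i \<omega>) > 1}) < \<infinity> \<and>
     (\<Sum>j. emeasure M {\<omega> \<in> space M. d j (Y j \<omega>) > 1}) < \<infinity>) \<and>
    (\<Sum>i. \<Sum>j. \<integral>\<^sup>+\<omega>. ennreal (min ((h i j (X i \<omega>, Y j \<omega>))\<^sup>2) 1) *
       indicator {\<omega>. c i (X i \<omega>) \<le> 1 \<and> d j (Y j \<omega>) \<le> 1} \<omega> \<partial>M) < \<infinity>"
proof -
  define f where "f i j z = min ((h i j z)\<^sup>2) 1" for i j z
  interpret K: two_sample_kernel M M E E X Y f
  proof
    show "indep_vars (\<lambda>_. E) X UNIV"
      using indep_vars_coded_family[of VX fst E] by (simp add: inj_def coded_def)
    show "indep_vars (\<lambda>_. E) Y UNIV"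
      using indep_vars_coded_family[of VY fst E] by (simp add: inj_def coded_def)
    show "f i j \<in> borel_measurable (E \<Otimes>\<^sub>M E)" for i j unfolding f_def by measurable
  qed (auto simp: f_def)
  have c: "K.row_mean = c" and d: "K.col_mean = d"
    by (auto simp: fun_eq_iff c_def d_def K.row_mean_def K.col_mean_def row_sum_def col_sum_def f_def)
  have truncated_mean: "(\<integral>\<^sup>+z. ennreal (K.truncated i j (X i (fst z), Y j (snd z))) \<partial>(M \<Otimes>\<^sub>M M))
      = (\<integral>\<^sup>+\<omega>. ennreal (min ((h i j (X i \<omega>, Y j \<omega>))\<^sup>2) 1) *
       indicator {\<omega>. c i (X i \<omega>) \<le> 1 \<and> d j (Y j \<omega>) \<le> 1} \<omega> \<partial>M)" for i j
  proof -
    interpret T: two_sample_kernel M M E E X Y K.truncated by (rule K.truncated_kernel)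
    have "(\<integral>\<^sup>+z. ennreal (K.truncated i j (X i (fst z), Y j (snd z))) \<partial>(M \<Otimes>\<^sub>M M))
        = (\<integral>\<^sup>+\<omega>. ennreal (K.truncated i j (X i \<omega>, Y j \<omega>)) \<partial>M)"
      using nn_integral_decouples[OF decouples_X_Y, of "\<lambda>z. ennreal (K.truncated i j (fst z i, snd z j))"] by simp
    also have "\<dots> = (\<integral>\<^sup>+\<omega>. ennreal (min ((h i j (X i \<omega>, Y j \<omega>))\<^sup>2) 1) *
       indicator {\<omega>. c i (X i \<omega>) \<le> 1 \<and> d j (Y j \<omega>) \<le> 1} \<omega> \<partial>M)"
      by (intro nn_integral_cong) (auto simp: K.truncated_def c d f_def indicator_def)
    finally show ?thesis .
  qed
  have "(AE \<omega> in M. (\<Sum>i. \<Sum>j. ennreal ((h i j (X i \<omega>, Y j \<omega>))\<^sup>2)) < \<infinity>)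
      \<longleftrightarrow> (AE \<omega> in M. (\<Sum>i. \<Sum>j. ennreal (f i j (X i \<omega>, Y j \<omega>))) < \<infinity>)"
    by (simp only: f_def suminf_suminf_min_1_finite_iff[OF zero_le_power2])
  also have "\<dots> \<longleftrightarrow> (AE z in M \<Otimes>\<^sub>M M. K.total (fst z) (snd z) < \<infinity>)"
    unfolding K.total_def
    by (rule AE_decouples_iff[OF decouples_X_Y, of "\<lambda>x y. (\<Sum>i. \<Sum>j. ennreal (f i j (x i, y j))) < \<infinity>"]) measurable
  also note K.total_finite_iff
  finally show ?thesis unfolding c d truncated_mean .
qed

end

theorem theorem5:
  fixes M :: "'a measure" and E :: "'e measure"
    and X Y :: "nat \<Rightarrow> 'a \<Rightarrow> 'e"
    and \<epsilon>1 \<epsilon>2 :: "nat \<Rightarrow> 'a \<Rightarrow> real"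
    and h :: "nat \<Rightarrow> nat \<Rightarrow> 'e \<times> 'e \<Rightarrow> real"
    and c d :: "nat \<Rightarrow> 'e \<Rightarrow> ennreal"
    and A B C1 C2 C3 :: bool
  assumes "decoupled_rademacher M E X Y \<epsilon>1 \<epsilon>2"
    and "\<And>i j. h i j \<in> borel_measurable (E \<Otimes>\<^sub>M E)"
  defines "c \<equiv> row_sum M Y h"
    and "d \<equiv> col_sum M X h"
  defines "A \<equiv> (AE \<omega> in M. convergent (\<lambda>n. \<Sum>i<n. \<Sum>j<n.
                    \<epsilon>1 i \<omega> * \<epsilon>2 j \<omega> * h i j (X i \<omega>, Y j \<omega>)))"
    and "B \<equiv> (AE \<omega> in M. (\<Sum>i. \<Sum>j. ennreal ((h i j (X i \<omega>, Y j \<omega>))\<^sup>2)) < \<infinity>)"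
    and "C1 \<equiv> (\<forall>i. AE \<omega> in M. c i (X i \<omega>) < \<infinity>) \<and> (\<forall>j. AE \<omega> in M. d j (Y j \<omega>) < \<infinity>)"
    and "C2 \<equiv> (\<Sum>i. emeasure M {\<omega> \<in> space M. c i (X i \<omega>) > 1}) < \<infinity> \<and>
              (\<Sum>j. emeasure M {\<omega> \<in> space M. d j (Y j \<omega>) > 1}) < \<infinity>"
    and "C3 \<equiv> (\<Sum>i. \<Sum>j. \<integral>\<^sup>+\<omega>. ennreal (min ((h i j (X i \<omega>, Y j \<omega>))\<^sup>2) 1) *
                 indicator {\<omega>. c i (X i \<omega>) \<le> 1 \<and> d j (Y j \<omega>) \<le> 1} \<omega> \<partial>M) < \<infinity>"
  shows "(A \<longleftrightarrow> B) \<and> (B \<longleftrightarrow> C1 \<and> C2 \<and> C3)"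
proof -
  interpret decoupled_rademacher M E X Y \<epsilon>1 \<epsilon>2 by fact
  show ?thesis
    unfolding A_def B_def C1_def C2_def C3_def c_def d_def
    by (intro conjI chaos_convergent_iff_square_summable square_summable_iff assms(2))
qed

end
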